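(* Fix a prime $p$ and $\alpha\in(0,1/2]$. For each $n$ let $M_1,M_2$ be independent $n\times n$ random matrices over $\mathbb{F}_p$, each with independent entries, such that no entry takes any value with probability more than $1-\alpha$. Then for any $a,b,c\in\mathbb{Z}_{\ge 0}$, $$\lim_{n\to\infty}\mathbf{P}\big(\mathrm{corank}(M_1M_2)=c\mid\mathrm{corank}(M_1)=a\text{ and }\mathrm{corank}(M_2)=b\big)=p^{-(c-a)(c-b)}\frac{(p^{-1};p^{-1})_a\,(p^{-1};p^{-1})_b}{(p^{-1};p^{-1})_{c-b}\,(p^{-1};p^{-1})_{a+b-c}\,(p^{-1};p^{-1})_{c-a}}.$$
   Context: The corank of an $n\times n$ matrix $M$ is $n-\mathrm{rank}(M)$. For $m\ge 0$, $(p^{-1};p^{-1})_m:=\prod_{i=1}^m(1-p^{-i})$, and by convention $1/(p^{-1};p^{-1})_m=0$ if $m<0$, so the right-hand side is zero unless $a,b\le c\le a+b$. Entries need not be identically distributed. The conditional probability is considered for those $n$ for which the conditioning event has positive probability. *)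

theory Defs
  imports
    "HOL-Probability.Probability"
    "Jordan_Normal_Form.DL_Rank"
    "Berlekamp_Zassenhaus.Finite_Field"
begin

definition corank :: "'a::field mat \<Rightarrow> nat" where
  "corank A = dim_row A - vec_space.rank (dim_row A) A"

text \<open>The empty matrix has no entries, so for \<open>n = 0\<close> only measurability remains.\<close>

definition balanced_random_matrix ::
    "real \<Rightarrow> nat \<Rightarrow> 'w measure \<Rightarrow> ('w \<Rightarrow> 'a::field mat) \<Rightarrow> bool" where
  "balanced_random_matrix \<alpha> n \<Omega> M \<longleftrightarrow>
     M \<in> measurable \<Omega> (count_space (carrier_mat n n)) \<and>
     prob_space.indep_vars \<Omega> (\<lambda>_. count_space UNIV)
       (\<lambda>(i, j) \<omega>. M \<omega> $$ (i, j)) ({..<n} \<times> {..<n}) \<and>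
     (\<forall>i<n. \<forall>j<n. \<forall>x. \<P>(\<omega> in \<Omega>. M \<omega> $$ (i, j) = x) \<le> 1 - \<alpha>)"

text \<open>\<open>qpoch p m\<close> is $(p^{-1};p^{-1})_m$. Its reciprocal \<open>inv_qpoch p m\<close> is extended by
  zero to negative \<open>m\<close>; \<open>qpoch\<close> itself is only meaningful for natural \<open>m\<close>.\<close>

definition qpoch :: "nat \<Rightarrow> nat \<Rightarrow> real" where
  "qpoch p m = (\<Prod>i = 1..m. 1 - 1 / real p ^ i)"

definition inv_qpoch :: "nat \<Rightarrow> int \<Rightarrow> real" where
  "inv_qpoch p m = (if m < 0 then 0 else 1 / qpoch p (nat m))"

end

theory Submission
  imports Defs "Berlekamp_Zassenhaus.Berlekamp_Type_Based"
begin

text \<open>Since \<open>corank (A * B) = corank B + dim (ker A \<inter> im B)\<close>, independence allows us to fix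
  \<open>M2 = B\<close> and to study \<open>ker M1\<close> relative to the fixed subspace \<open>H = im B\<close> of codimension \<open>b\<close>.
  Reveal the rows of \<open>M1\<close> one at a time and let \<open>U\<close> be the space of vectors orthogonal to the
  revealed rows. A uniform row is orthogonal to all of \<open>U\<close> with probability \<open>1 / |U|\<close>, so for a
  uniform matrix the pair \<open>(dim U, dim (U \<inter> H))\<close> is a Markov chain, whose law has a closed product
  form. For a row with independent non-concentrated entries, Fourier inversion bounds the deviation
  from \<open>1 / |U|\<close> by the average of \<open>\<rho> ^ weight u\<close> over nonzero \<open>u \<in> U\<close>. Vectors of large weight
  contribute little; those of small weight are few, make up a negligible part of \<open>U\<close> while \<open>U\<close>
  is large, and survive \<open>k\<close> rows with probability at most \<open>\<beta> ^ k\<close>. Hence the expected deviations,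
  summed over all rows, tend to zero uniformly in \<open>H\<close> and in the entry laws, and the limit is the
  one of the uniform model. The conditioning is harmless because every corank has positive
  limiting probability.\<close>

section \<open>Subspaces and coranks over finite fields\<close>

no_notation inner (infix "\<bullet>" 70)
no_notation vec_nth (infixl "$" 90)

text \<open>The deviations of all n rows are added, so each has to be well below 1/n, although 1/|U|
  is of constant order for the last rows. Neither source of smallness suffices alone: for early rows
  U is so large that light vectors are a negligible share of it, but hardly any vector has been
  removed; for late rows U may be small, but a fixed nonzero vector has survived only with
  exponentially small probability. Splitting at n/2 yields the factor
  \<open>sqrt \<beta> ^ n\<close> in both regimes. It has to beat the number of light vectors, which
  the generating function \<open>(1 + (CARD('a) - 1) * \<mu>) ^ n\<close> controls; \<mu> is chosen
  so small that the product of the two still decays, and "light" means weight below a small constant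
  fraction of n.

  Both dimensions are followed jointly because the corank of the first matrix is conditioned on. Its
  own law is the case where H is the whole space. Each limiting law contains the infinite product of
  the factors 1 - p^(-i), which cancels in the conditional probability.\<close>

definition is_subspace :: "nat \<Rightarrow> 'a::field vec set \<Rightarrow> bool" where
  "is_subspace n U \<longleftrightarrow> U \<subseteq> carrier_vec n \<and> 0\<^sub>v n \<in> U \<and>
     (\<forall>u\<in>U. \<forall>v\<in>U. u + v \<in> U) \<and> (\<forall>c. \<forall>u\<in>U. c \<cdot>\<^sub>v u \<in> U)"

definition orth_part :: "'a::field vec \<Rightarrow> 'a vec set \<Rightarrow> 'a vec set" where
  "orth_part r U = {u \<in> U. r \<bullet> u = 0}"

definition mat_ker :: "nat \<Rightarrow> 'a::field mat \<Rightarrow> 'a vec set" where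
  "mat_ker n A = {x \<in> carrier_vec n. A *\<^sub>v x = 0\<^sub>v n}"

lemma card_field_gt_1: "1 < CARD('a::{finite,field})"
  using card_mono[of UNIV "{0::'a, 1}"] by simp

lemma orth_part_subset: "orth_part r U \<subseteq> U"
  by (auto simp: orth_part_def)

lemma orth_part_Int: "orth_part r (U \<inter> H) = orth_part r U \<inter> H"
  by (auto simp: orth_part_def)

lemma is_subspace_carrier: "is_subspace n U \<Longrightarrow> U \<subseteq> carrier_vec n"
  by (simp add: is_subspace_def)

lemma is_subspace_diff:
  assumes "is_subspace n U" "u \<in> U" "v \<in> U"
  shows "u - v \<in> U"
proof -
  have "u + (- 1) \<cdot>\<^sub>v v \<in> U" using assms by (auto simp: is_subspace_def)
  moreover have "u + (- 1) \<cdot>\<^sub>v v = u - v"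
    using assms is_subspace_carrier[OF assms(1)] by (intro eq_vecI) auto
  ultimately show ?thesis by simp
qed

lemma is_subspace_carrier_vec: "is_subspace n (carrier_vec n)"
  by (auto simp: is_subspace_def)

lemma is_subspace_Int: "is_subspace n U \<Longrightarrow> is_subspace n H \<Longrightarrow> is_subspace n (U \<inter> H)"
  by (auto simp: is_subspace_def)

lemma is_subspace_orth_part:
  assumes "r \<in> carrier_vec n" "is_subspace n U"
  shows "is_subspace n (orth_part r U)"
proof -
  have U: "u \<in> U \<Longrightarrow> u \<in> carrier_vec n" for u using is_subspace_carrier[OF assms(2)] by auto
  show ?thesis using assms U
    unfolding is_subspace_def orth_part_def
    by (auto simp: scalar_prod_add_distrib[of r n])
qed

text \<open>Rank-nullity by counting: every nonempty fibre of f is a translate of K. Only a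
  condition on differences is asked of f, so one lemma serves scalar products with a row,
  multiplication by a matrix, and a matrix restricted to a kernel.\<close>

lemma card_fibres:
  assumes U: "is_subspace n U" and fin: "finite U" and K: "K \<subseteq> U"
    and f: "\<And>u v. u \<in> U \<Longrightarrow> v \<in> U \<Longrightarrow> f u = f v \<longleftrightarrow> u - v \<in> K"
  shows "card U = card K * card (f ` U)"
proof -
  have car: "u \<in> U \<Longrightarrow> u \<in> carrier_vec n" for u using is_subspace_carrier[OF U] by auto
  have fib: "card {u \<in> U. f u = y} = card K" if y: "y \<in> f ` U" for y
  proof -
    obtain u0 where u0: "u0 \<in> U" "y = f u0" using y by auto
    have "{u \<in> U. f u = y} = (\<lambda>k. k + u0) ` K"
    proof (intro Set.set_eqI iffI)
      fix u assume u: "u \<in> {u \<in> U. f u = y}"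
      then have "u - u0 \<in> K" using f u0 by auto
      moreover have "u = (u - u0) + u0" using u u0 car[of u] car[of u0]
        by (intro eq_vecI) auto
      ultimately show "u \<in> (\<lambda>k. k + u0) ` K" by blast
    next
      fix u assume "u \<in> (\<lambda>k. k + u0) ` K"
      then obtain k where k: "k \<in> K" "u = k + u0" by auto
      then have uU: "u \<in> U" using u0 K U by (auto simp: is_subspace_def)
      have kU: "k \<in> U" using k K by auto
      have "u - u0 = k" using car[OF kU] car[OF u0(1)] k by (intro eq_vecI) auto
      then show "u \<in> {u \<in> U. f u = y}" using f[OF uU u0(1)] k uU u0 by auto
    qed
    moreover have "inj_on (\<lambda>k. k + u0) K"
    proof (rule inj_onI)
      fix k l assume kl: "k \<in> K" "l \<in> K" "k + u0 = l + u0"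
      then have "k \<in> carrier_vec n" "l \<in> carrier_vec n" using car K by auto
      moreover have "x = x + u0 - u0" if "x \<in> carrier_vec n" for x
        using that car[OF u0(1)] by (intro eq_vecI) auto
      ultimately show "k = l" using kl(3) by metis
    qed
    ultimately show ?thesis by (simp add: card_image)
  qed
  have "card U = (\<Sum>y\<in>f ` U. card {u \<in> U. f u = y})"
    using sum.image_gen[OF fin, of "\<lambda>_. 1::nat" f] by simp
  also have "\<dots> = (\<Sum>y\<in>f ` U. card K)" using fib by (intro sum.cong) auto
  finally show ?thesis by simp
qed

lemma finite_is_subspace: "is_subspace n U \<Longrightarrow> finite (U :: 'a::{finite,field} vec set)"
  by (rule finite_subset[OF is_subspace_carrier]) auto

text \<open>A nonzero functional on U takes every value, since values can be rescaled, so its kernel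
  has index \<open>CARD('a)\<close>. This is why a row lowers a dimension by 0 or 1.\<close>

lemma card_orth_part:
  fixes U :: "'a::{finite,field} vec set"
  assumes r: "r \<in> carrier_vec n" and U: "is_subspace n U" and ne: "orth_part r U \<noteq> U"
  shows "card U = CARD('a) * card (orth_part r U)"
proof -
  have car: "u \<in> U \<Longrightarrow> u \<in> carrier_vec n" for u using is_subspace_carrier[OF U] by auto
  have "card U = card (orth_part r U) * card ((\<lambda>u. r \<bullet> u) ` U)"
  proof (rule card_fibres[OF U finite_is_subspace[OF U] orth_part_subset])
    fix u v assume uv: "u \<in> U" "v \<in> U"
    then have "r \<bullet> (u - v) = r \<bullet> u - r \<bullet> v"
      using r car by (intro scalar_prod_minus_distrib) auto
    then show "r \<bullet> u = r \<bullet> v \<longleftrightarrow> u - v \<in> orth_part r U"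
      using is_subspace_diff[OF U uv] by (auto simp: orth_part_def)
  qed
  moreover have "(\<lambda>u. r \<bullet> u) ` U = UNIV"
  proof -
    obtain u where u: "u \<in> U" "r \<bullet> u \<noteq> 0" using ne by (auto simp: orth_part_def)
    have "y \<in> (\<lambda>u. r \<bullet> u) ` U" for y
    proof -
      have "(y / (r \<bullet> u)) \<cdot>\<^sub>v u \<in> U" using U u by (auto simp: is_subspace_def)
      moreover have "r \<bullet> ((y / (r \<bullet> u)) \<cdot>\<^sub>v u) = y" using u r car[OF u(1)] by simp
      ultimately show ?thesis by (metis imageI)
    qed
    then show ?thesis by auto
  qed
  ultimately show ?thesis by simp
qed

section \<open>Rank and corank through cardinalities\<close>

lemma mult_mat_vec_minus_distrib:
  fixes A :: "'a::field mat"
  assumes "A \<in> carrier_mat n m" "u \<in> carrier_vec m" "v \<in> carrier_vec m"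
  shows "A *\<^sub>v (u - v) = A *\<^sub>v u - A *\<^sub>v v"
  using assms by (intro eq_vecI) (auto simp: scalar_prod_minus_distrib[of _ m])

lemma card_mat_image:
  fixes A :: "'a::{finite,field} mat"
  assumes A: "A \<in> carrier_mat n m"
  shows "card {x \<in> carrier_vec m. A *\<^sub>v x = 0\<^sub>v n} * card ((\<lambda>x. A *\<^sub>v x) ` carrier_vec m) = CARD('a) ^ m"
proof -
  have "card (carrier_vec m :: 'a vec set) =
      card {x \<in> carrier_vec m. A *\<^sub>v x = 0\<^sub>v n} * card ((\<lambda>x. A *\<^sub>v x) ` carrier_vec m)"
  proof (rule card_fibres[OF is_subspace_carrier_vec])
    fix u v :: "'a vec" assume uv: "u \<in> carrier_vec m" "v \<in> carrier_vec m"
    have "A *\<^sub>v u = A *\<^sub>v v \<longleftrightarrow> A *\<^sub>v u - A *\<^sub>v v = 0\<^sub>v n"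
      using A uv by (auto simp: vec_eq_iff)
    then show "A *\<^sub>v u = A *\<^sub>v v \<longleftrightarrow> u - v \<in> {x \<in> carrier_vec m. A *\<^sub>v x = 0\<^sub>v n}"
      using mult_mat_vec_minus_distrib[OF A uv] uv by auto
  qed auto
  then show ?thesis by (simp add: card_carrier_vec)
qed

lemma mat_image_eq_span:
  fixes A :: "'a::field mat"
  assumes A: "A \<in> carrier_mat n m"
  shows "(\<lambda>x. A *\<^sub>v x) ` carrier_vec m = LinearCombinations.module.span class_ring (module_vec TYPE('a) n) (set (cols A))"
proof -
  interpret vec_space "TYPE('a)" n .
  have "span (set (cols A)) = {y \<in> carrier_vec n. \<exists>x\<in>carrier_vec m. A *\<^sub>v x = y}"
    using col_space_eq[OF A] A unfolding col_space_def by simp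
  also have "\<dots> = (\<lambda>x. A *\<^sub>v x) ` carrier_vec m"
    using mult_mat_vec_carrier[OF A] by blast
  finally show ?thesis by simp
qed

text \<open>The rank is read off from a maximal independent set S of columns. The matrix with
  columns S is injective on coordinate vectors, so \<open>span S\<close> has
  \<open>CARD('a) ^ card S\<close> elements, and maximality puts every column into
  \<open>span S\<close>.\<close>

lemma card_mat_image_rank:
  fixes A :: "'a::{finite,field} mat"
  assumes A: "A \<in> carrier_mat n m"
  shows "card ((\<lambda>x. A *\<^sub>v x) ` carrier_vec m) = CARD('a) ^ vec_space.rank n A"
proof -
  interpret vec_space "TYPE('a)" n .
  have li0: "lin_indpt {}" by (simp add: lin_dep_def)
  obtain S where S: "maximal S (\<lambda>T. T \<subseteq> set (cols A) \<and> lin_indpt T)" "finite S"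
    using maximal_exists_superset[of "set (cols A)" "\<lambda>T. T \<subseteq> set (cols A) \<and> lin_indpt T" "{}"] li0
    by (metis (no_types, lifting) List.finite_set empty_subsetI)
  have li: "lin_indpt S" and sub: "S \<subseteq> set (cols A)" using S by (auto simp: maximal_def)
  have colsA: "set (cols A) \<subseteq> carrier_vec n" using cols_dim A by blast
  then have Sn: "S \<subseteq> carrier_vec n" using sub by auto
  obtain xs where xs: "set xs = S" "distinct xs" using finite_distinct_list[OF S(2)] by auto
  define B where "B = mat_of_cols n xs"
  define k where "k = card S"
  have "length xs = k" using distinct_card[of xs] xs by (simp add: k_def)
  then have B: "B \<in> carrier_mat n k" unfolding B_def by (metis mat_of_cols_carrier(1))
  have c: "cols B = xs" using xs Sn by (simp add: B_def cols_mat_of_cols)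
  have spanS: "span S = (\<lambda>x. B *\<^sub>v x) ` carrier_vec k"
    using mat_image_eq_span[OF B] c xs(1) by simp
  have "card (span S) = card (carrier_vec k :: 'a vec set)"
    unfolding spanS
  proof (rule card_image, rule inj_onI)
    fix x y :: "'a vec" assume xy: "x \<in> carrier_vec k" "y \<in> carrier_vec k" "B *\<^sub>v x = B *\<^sub>v y"
    have "B *\<^sub>v (x - y) = 0\<^sub>v n"
      using mult_mat_vec_minus_distrib[OF B xy(1,2)] xy B by auto
    then have "x - y = 0\<^sub>v k"
      using lin_depI[OF B, of "x - y"] li c xs xy by auto
    then show "x = y" using xy by (auto simp: vec_eq_iff)
  qed
  then have cardS: "card (span S) = CARD('a) ^ rank A"
    using rank_card_indpt[OF A S(1)] by (simp add: card_carrier_vec k_def)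
  have colspan: "set (cols A) \<subseteq> span S"
  proof
    fix v assume v: "v \<in> set (cols A)"
    show "v \<in> span S"
    proof (rule ccontr)
      assume nv: "v \<notin> span S"
      then have "v \<notin> S" using in_own_span[of S] Sn by auto
      moreover have "lin_indpt (S \<union> {v})"
        using lin_dep_iff_in_span[of S v] Sn li v colsA nv \<open>v \<notin> S\<close> by blast
      ultimately show False using S(1) v sub unfolding maximal_def by blast
    qed
  qed
  have "span (set (cols A)) = span S"
  proof
    show "span (set (cols A)) \<subseteq> span S"
      using colspan Sn span_is_subset[of "set (cols A)" "span S"] span_is_submodule by blast
    show "span S \<subseteq> span (set (cols A))" using sub span_is_monotone by blast
  qed
  moreover have "span (set (cols A)) = (\<lambda>x. A *\<^sub>v x) ` carrier_vec m"
    using mat_image_eq_span[OF A] by simp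
  ultimately show ?thesis using cardS by simp
qed

lemma card_mat_ker:
  fixes A :: "'a::{finite,field} mat"
  assumes A: "A \<in> carrier_mat n n"
  shows "card (mat_ker n A) = CARD('a) ^ corank A"
proof -
  have "card (mat_ker n A) * CARD('a) ^ vec_space.rank n A = CARD('a) ^ n"
    using card_mat_image[OF A] card_mat_image_rank[OF A] by (simp add: mat_ker_def)
  also have "\<dots> = CARD('a) ^ corank A * CARD('a) ^ vec_space.rank n A"
    using A vec_space.rank_le_nc[OF A] by (simp add: corank_def flip: power_add)
  finally show ?thesis by simp
qed

lemma card_image_corank:
  fixes A :: "'a::{finite,field} mat"
  assumes A: "A \<in> carrier_mat n n"
  shows "card ((\<lambda>x. A *\<^sub>v x) ` carrier_vec n) = CARD('a) ^ (n - corank A)" and "corank A \<le> n"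
proof -
  have "n - corank A = vec_space.rank n A" using A vec_space.rank_le_nc[OF A] by (simp add: corank_def)
  then show "card ((\<lambda>x. A *\<^sub>v x) ` carrier_vec n) = CARD('a) ^ (n - corank A)" and "corank A \<le> n"
    using card_mat_image_rank[OF A] A by (auto simp: corank_def)
qed

lemma is_subspace_mat_ker: "A \<in> carrier_mat n n \<Longrightarrow> is_subspace n (mat_ker n A)"
  unfolding is_subspace_def mat_ker_def
  by (auto simp: mult_add_distrib_mat_vec[of A n n] mult_mat_vec[of A n n])

lemma is_subspace_image:
  assumes A: "A \<in> carrier_mat n n"
  shows "is_subspace n ((\<lambda>x. A *\<^sub>v x) ` carrier_vec n)"
  unfolding is_subspace_def
proof (intro conjI ballI allI)
  show "0\<^sub>v n \<in> (*\<^sub>v) A ` carrier_vec n" using A by (intro image_eqI[of _ _ "0\<^sub>v n"]) auto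
next
  fix u v assume "u \<in> (*\<^sub>v) A ` carrier_vec n" "v \<in> (*\<^sub>v) A ` carrier_vec n"
  then obtain x y where "x \<in> carrier_vec n" "y \<in> carrier_vec n" "u = A *\<^sub>v x" "v = A *\<^sub>v y" by auto
  then show "u + v \<in> (*\<^sub>v) A ` carrier_vec n"
    using mult_add_distrib_mat_vec[OF A] by (intro image_eqI[of _ _ "x + y"]) auto
next
  fix c u assume "u \<in> (*\<^sub>v) A ` carrier_vec n"
  then obtain x where "x \<in> carrier_vec n" "u = A *\<^sub>v x" by auto
  then show "c \<cdot>\<^sub>v u \<in> (*\<^sub>v) A ` carrier_vec n"
    using mult_mat_vec[OF A] by (intro image_eqI[of _ _ "c \<cdot>\<^sub>v x"]) auto
qed (use A in auto)

text \<open>B maps the kernel of \<open>A * B\<close> onto the intersection, and the fibres of this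
  map are translates of the kernel of B.\<close>

lemma card_mat_ker_mult:
  fixes A B :: "'a::{finite,field} mat"
  assumes A: "A \<in> carrier_mat n n" and B: "B \<in> carrier_mat n n"
  shows "card (mat_ker n (A * B)) = card (mat_ker n B) * card (mat_ker n A \<inter> (\<lambda>x. B *\<^sub>v x) ` carrier_vec n)"
proof -
  have AB: "A * B \<in> carrier_mat n n" using A B by simp
  have "card (mat_ker n (A * B)) = card (mat_ker n B) * card ((\<lambda>x. B *\<^sub>v x) ` mat_ker n (A * B))"
  proof (rule card_fibres[OF is_subspace_mat_ker[OF AB] finite_is_subspace[OF is_subspace_mat_ker[OF AB]]])
    show "mat_ker n B \<subseteq> mat_ker n (A * B)" using A B by (auto simp: mat_ker_def assoc_mult_mat_vec[OF A B])
    fix u v assume "u \<in> mat_ker n (A * B)" "v \<in> mat_ker n (A * B)"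
    then have uv: "u \<in> carrier_vec n" "v \<in> carrier_vec n" by (auto simp: mat_ker_def)
    have "B *\<^sub>v u = B *\<^sub>v v \<longleftrightarrow> B *\<^sub>v u - B *\<^sub>v v = 0\<^sub>v n"
      using B uv by (auto simp: vec_eq_iff)
    then show "B *\<^sub>v u = B *\<^sub>v v \<longleftrightarrow> u - v \<in> mat_ker n B"
      using mult_mat_vec_minus_distrib[OF B uv] uv by (auto simp: mat_ker_def)
  qed
  moreover have "(\<lambda>x. B *\<^sub>v x) ` mat_ker n (A * B) = mat_ker n A \<inter> (\<lambda>x. B *\<^sub>v x) ` carrier_vec n"
    using A B by (auto simp: mat_ker_def assoc_mult_mat_vec[OF A B] image_iff)
  ultimately show ?thesis by simp
qed

text \<open>Logarithms are taken in \<open>card_mat_ker_mult\<close>; the two inequalities reflect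
  that the intersection has at least one element and at most as many as the kernel of A.\<close>

lemma corank_mult_eq_iff:
  fixes A B :: "'a::{finite,field} mat"
  assumes A: "A \<in> carrier_mat n n" and B: "B \<in> carrier_mat n n"
  shows "corank (A * B) = corank B + j \<longleftrightarrow>
    card (mat_ker n A \<inter> (\<lambda>x. B *\<^sub>v x) ` carrier_vec n) = CARD('a) ^ j"
    and "corank B \<le> corank (A * B)" and "corank (A * B) \<le> corank A + corank B"
proof -
  let ?I = "mat_ker n A \<inter> (\<lambda>x. B *\<^sub>v x) ` carrier_vec n"
  have q: "1 < CARD('a)" by (rule card_field_gt_1)
  have eq: "CARD('a) ^ corank (A * B) = CARD('a) ^ corank B * card ?I"
    using card_mat_ker_mult[OF A B] A B by (simp add: card_mat_ker)
  have fin: "finite (mat_ker n A)" using finite_is_subspace[OF is_subspace_mat_ker[OF A]] .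
  have "0\<^sub>v n \<in> ?I" using is_subspace_Int[OF is_subspace_mat_ker[OF A] is_subspace_image[OF B]] by (simp add: is_subspace_def)
  then have pos: "1 \<le> card ?I" using fin by (metis One_nat_def Suc_leI card_gt_0_iff empty_iff finite_Int)
  have le: "card ?I \<le> CARD('a) ^ corank A"
    using card_mono[OF fin, of ?I] card_mat_ker[OF A] by simp
  show "corank (A * B) = corank B + j \<longleftrightarrow> card ?I = CARD('a) ^ j"
  proof -
    have "corank (A * B) = corank B + j \<longleftrightarrow> CARD('a) ^ corank (A * B) = CARD('a) ^ (corank B + j)"
      using q by (metis power_inject_exp)
    then show ?thesis using eq q by (simp add: power_add)
  qed
  have "CARD('a) ^ corank B \<le> CARD('a) ^ corank (A * B)" using eq pos by simp
  then show "corank B \<le> corank (A * B)" using q by (meson power_le_imp_le_exp)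
  have "CARD('a) ^ corank (A * B) \<le> CARD('a) ^ (corank A + corank B)" using eq le by (simp add: power_add mult.commute)
  then show "corank (A * B) \<le> corank A + corank B" using q by (meson power_le_imp_le_exp)
qed

section \<open>Additive characters and orthogonality\<close>

definition add_char :: "'p::prime_card mod_ring \<Rightarrow> complex" where
  "add_char x = cis (2 * pi * of_int (to_int_mod_ring x) / real CARD('p))"

lemma add_char_0 [simp]: "add_char 0 = 1"
  by (simp add: add_char_def)

lemma norm_add_char [simp]: "norm (add_char x) = 1"
  by (simp add: add_char_def)

lemma add_char_add: "add_char (x + y) = add_char x * add_char (y :: 'p::prime_card mod_ring)"
proof -
  define N where "N = int CARD('p)"
  have N: "N > 0" by (simp add: N_def)
  define a b where "a = to_int_mod_ring x" and "b = to_int_mod_ring y"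
  have s: "to_int_mod_ring (x + y) = (a + b) mod N"
    unfolding a_def b_def N_def by transfer simp
  have "(a + b) = (a + b) mod N + N * ((a + b) div N)" by simp
  then have e: "real_of_int (a + b) = of_int ((a + b) mod N) + of_int N * of_int ((a + b) div N)"
    by (metis of_int_add of_int_mult)
  have "add_char x * add_char y = cis (2 * pi * of_int a / of_int N + 2 * pi * of_int b / of_int N)"
    by (simp add: add_char_def a_def b_def N_def cis_mult)
  also have "2 * pi * of_int a / of_int N + 2 * pi * of_int b / of_int N = 2 * pi * real_of_int (a + b) / of_int N"
    by (simp add: algebra_simps add_divide_distrib)
  also have "\<dots> = 2 * pi * of_int ((a + b) mod N) / of_int N + 2 * pi * of_int ((a + b) div N)"
    unfolding e using N by (simp add: field_simps)
  also have "cis \<dots> = cis (2 * pi * of_int ((a + b) mod N) / of_int N)"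
    by (simp flip: cis_mult add: cis_multiple_2pi)
  also have "\<dots> = add_char (x + y)" by (simp add: add_char_def s N_def)
  finally show ?thesis by simp
qed

lemma add_char_eq_1_iff: "add_char x = 1 \<longleftrightarrow> x = (0 :: 'p::prime_card mod_ring)"
proof
  assume "add_char x = 1"
  then have "cos (2 * pi * of_int (to_int_mod_ring x) / real CARD('p)) = 1"
    unfolding add_char_def by (metis cis.sel(1) one_complex.sel(1))
  then obtain k :: int where k: "2 * pi * of_int (to_int_mod_ring x) / real CARD('p) = of_int k * 2 * pi"
    by (auto simp: cos_one_2pi_int)
  then have "real_of_int (to_int_mod_ring x) = of_int k * real CARD('p)"
    by (simp add: field_simps)
  then have k': "to_int_mod_ring x = k * int CARD('p)" by (metis of_int_eq_iff of_int_mult of_int_of_nat_eq)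
  have "to_int_mod_ring x \<in> {0..<int CARD('p)}" using range_to_int_mod_ring by blast
  then have "to_int_mod_ring x = to_int_mod_ring x mod int CARD('p)" by simp
  also have "\<dots> = 0" using k' by simp
  finally show "x = 0" by simp
qed simp

lemma add_char_uminus: "add_char (- x) = cnj (add_char x)"
proof -
  have "add_char (- x) * add_char x = 1" by (simp flip: add_char_add)
  moreover have "cnj (add_char x) * add_char x = 1"
    by (simp add: add_char_def cis_cnj cis_mult)
  ultimately show ?thesis by (metis mult_right_cancel norm_add_char norm_zero zero_neq_one)
qed

lemma add_char_diff: "add_char (x - y) = add_char x * cnj (add_char y)"
  using add_char_add[of x "- y"] by (simp add: add_char_uminus)

lemma add_char_sum: "add_char (\<Sum>i\<in>A. f i) = (\<Prod>i\<in>A. add_char (f i))"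
  by (induction A rule: infinite_finite_induct) (auto simp: add_char_add)

section \<open>Row laws and their Fourier transforms\<close>

text \<open>Laws replace random variables: \<open>w j x\<close> is the probability that entry j
  equals x. Estimates for rows thereby become finite sums, and probability spaces enter only when
  the law of a matrix is identified.\<close>

definition balanced_row :: "real \<Rightarrow> nat \<Rightarrow> (nat \<Rightarrow> 'a::{finite,field} \<Rightarrow> real) \<Rightarrow> bool" where
  "balanced_row \<alpha> n w \<longleftrightarrow> (\<forall>j<n. (\<forall>x. 0 \<le> w j x \<and> w j x \<le> 1 - \<alpha>) \<and> (\<Sum>x\<in>UNIV. w j x) = 1)"

definition row_prob :: "nat \<Rightarrow> (nat \<Rightarrow> 'a \<Rightarrow> real) \<Rightarrow> 'a vec \<Rightarrow> real" where
  "row_prob n w r = (\<Prod>j<n. w j (r $ j))"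

definition hamming_weight :: "nat \<Rightarrow> 'a::zero vec \<Rightarrow> nat" where
  "hamming_weight n u = card {j \<in> {..<n}. u $ j \<noteq> 0}"

lemma Re_add_char_gap:
  obtains \<kappa> where "\<kappa> < 1" "\<And>x :: 'p::prime_card mod_ring. x \<noteq> 0 \<Longrightarrow> Re (add_char x) \<le> \<kappa>"
proof -
  define S where "S = (\<lambda>x. Re (add_char x)) ` (UNIV - {0 :: 'p mod_ring})"
  have S: "finite S" "S \<noteq> {}" by (auto simp: S_def intro: exI[of _ 1])
  have lt: "Re (add_char x) < 1" if "x \<noteq> 0" for x :: "'p mod_ring"
  proof (rule ccontr)
    assume "\<not> Re (add_char x) < 1"
    then have 1: "Re (add_char x) = 1" using complex_Re_le_cmod[of "add_char x"] by simp
    then have "Im (add_char x) = 0" using cmod_power2[of "add_char x"] by simp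
    then show False using 1 that add_char_eq_1_iff[of x] by (simp add: complex_eq_iff)
  qed
  show ?thesis
  proof (rule that[of "Max S"])
    show "Max S < 1" using S lt by (auto simp: S_def)
    show "Re (add_char x) \<le> Max S" if "x \<noteq> 0" for x :: "'p mod_ring"
      using S that by (intro Max_ge) (auto simp: S_def)
  qed
qed

definition char_bound :: "'p::prime_card mod_ring itself \<Rightarrow> real \<Rightarrow> real \<Rightarrow> bool" where
  "char_bound T \<alpha> \<rho> \<longleftrightarrow> 0 < \<rho> \<and> \<rho> < 1 \<and>
    (\<forall>w t. (\<forall>x. 0 \<le> w x \<and> w x \<le> 1 - \<alpha>) \<and> (\<Sum>x\<in>UNIV. w x) = 1 \<and> t \<noteq> (0 :: 'p mod_ring) \<longrightarrow>
       norm (\<Sum>x\<in>UNIV. of_real (w x) * add_char (x * t)) \<le> \<rho>)"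

text \<open>The squared norm is the mean of the character at (X - X') * t, where X' is an
  independent copy of X. The diagonal X = X' has mass at most 1 - \<alpha>, and off it the real part
  is at most \<kappa>, which gives the bound 1 - \<alpha> * (1 - \<kappa>).\<close>

lemma char_bound_exists:
  assumes "0 < \<alpha>"
  obtains \<rho> where "char_bound TYPE('p::prime_card mod_ring) \<alpha> \<rho>"
proof -
  obtain \<kappa> where \<kappa>: "\<kappa> < 1" "\<And>x :: 'p::prime_card mod_ring. x \<noteq> 0 \<Longrightarrow> Re (add_char x) \<le> \<kappa>"
    using Re_add_char_gap by blast
  \<comment> \<open>The maximum with 1/4 secures 0 < \<rho>, whatever the size of \<alpha>.\<close>
  define \<rho> where "\<rho> = sqrt (max (1/4) (1 - \<alpha> * (1 - \<kappa>)))"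
  have \<rho>1: "\<rho> < 1" using assms \<kappa>(1) by (simp add: \<rho>_def)
  have \<rho>0: "0 < \<rho>" by (simp add: \<rho>_def)
  have "norm (\<Sum>x\<in>UNIV. of_real (w x) * add_char (x * t)) \<le> \<rho>"
    if w: "\<And>x. 0 \<le> w x" "\<And>x. w x \<le> 1 - \<alpha>" "(\<Sum>x\<in>UNIV. w x) = 1" and t: "t \<noteq> 0"
    for w and t :: "'p mod_ring"
  proof -
    define z where "z = (\<Sum>x\<in>UNIV. of_real (w x) * add_char (x * t))"
    have "(norm z)\<^sup>2 = Re (z * cnj z)"
      unfolding cmod_power2 by (simp add: power2_eq_square)
    also have "z * cnj z = (\<Sum>x\<in>UNIV. \<Sum>y\<in>UNIV. of_real (w x * w y) * add_char ((x - y) * t))"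
      by (simp add: z_def sum_product algebra_simps add_char_diff)
    also have "Re \<dots> = (\<Sum>x\<in>UNIV. \<Sum>y\<in>UNIV. w x * w y * Re (add_char ((x - y) * t)))"
      by simp
    also have "\<dots> \<le> (\<Sum>x\<in>UNIV. \<Sum>y\<in>UNIV. w x * w y * (\<kappa> + (1 - \<kappa>) * of_bool (x = y)))"
      using w \<kappa> t by (intro sum_mono mult_left_mono) auto
    also have "\<dots> = (\<Sum>x\<in>UNIV. \<kappa> * w x * (\<Sum>y\<in>UNIV. w y) + (1 - \<kappa>) * (w x * w x))"
      by (intro sum.cong refl)
        (simp add: algebra_simps sum.distrib sum_subtractf flip: sum_distrib_left)
    also have "\<dots> = \<kappa> + (1 - \<kappa>) * (\<Sum>x\<in>UNIV. w x * w x)"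
      using w(3) by (simp add: sum.distrib flip: sum_distrib_left)
    finally have 1: "(norm z)\<^sup>2 \<le> \<kappa> + (1 - \<kappa>) * (\<Sum>x\<in>UNIV. w x * w x)" .
    have "(\<Sum>x\<in>UNIV. w x * w x) \<le> (\<Sum>x\<in>UNIV. (1 - \<alpha>) * w x)"
      using w by (intro sum_mono mult_right_mono) auto
    also have "\<dots> = 1 - \<alpha>" using w(3) by (simp flip: sum_distrib_left)
    finally have "(1 - \<kappa>) * (\<Sum>x\<in>UNIV. w x * w x) \<le> (1 - \<kappa>) * (1 - \<alpha>)"
      using \<kappa>(1) by (intro mult_left_mono) auto
    with 1 have "(norm z)\<^sup>2 \<le> 1 - \<alpha> * (1 - \<kappa>)" by (simp add: algebra_simps)
    then have "(norm z)\<^sup>2 \<le> max (1/4) (1 - \<alpha> * (1 - \<kappa>))" by simp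
    then have "norm z \<le> \<rho>" unfolding \<rho>_def by (rule real_le_rsqrt)
    then show ?thesis by (simp add: z_def)
  qed
  then have "char_bound TYPE('p mod_ring) \<alpha> \<rho>"
    using \<rho>0 \<rho>1 unfolding char_bound_def by simp
  then show ?thesis by (rule that)
qed

lemma sum_carrier_vec_prod:
  fixes f :: "nat \<Rightarrow> 'a::finite \<Rightarrow> 'c::comm_semiring_1"
  shows "(\<Sum>r\<in>carrier_vec n. \<Prod>j<n. f j (r $ j)) = (\<Prod>j<n. \<Sum>x\<in>UNIV. f j x)"
proof -
  have "(\<Sum>r\<in>carrier_vec n. \<Prod>j<n. f j (r $ j)) = (\<Sum>g\<in>PiE {..<n} (\<lambda>_. UNIV). \<Prod>j<n. f j (g j))"
    by (rule sum.reindex_bij_witness[of _ "\<lambda>g. vec n g" "\<lambda>r. restrict (\<lambda>j. r $ j) {..<n}"])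
      (auto simp: PiE_def extensional_def fun_eq_iff)
  then show ?thesis by (simp add: prod_sum_PiE)
qed

lemma row_prob_nonneg: "balanced_row \<alpha> n w \<Longrightarrow> 0 \<le> row_prob n w r"
  by (auto simp: balanced_row_def row_prob_def intro!: prod_nonneg)

lemma sum_row_prob: "balanced_row \<alpha> n w \<Longrightarrow> (\<Sum>r\<in>carrier_vec n. row_prob n w r) = 1"
  by (simp add: row_prob_def sum_carrier_vec_prod balanced_row_def)

lemma sum_hamming_weight:
  fixes x :: real
  shows "(\<Sum>u\<in>(carrier_vec n :: 'a::{finite,zero} vec set). x ^ hamming_weight n u) = (1 + (real CARD('a) - 1) * x) ^ n"
proof -
  have "x ^ hamming_weight n u = (\<Prod>j<n. if u $ j = 0 then 1 else x)" for u :: "'a vec"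
    by (simp add: hamming_weight_def prod.If_cases Int_def Collect_neg_eq[symmetric] set_diff_eq)
  then have "(\<Sum>u\<in>carrier_vec n. x ^ hamming_weight n (u :: 'a vec)) = (\<Prod>j<n. \<Sum>y\<in>UNIV. if y = (0::'a) then 1 else x)"
    using sum_carrier_vec_prod[where f = "\<lambda>_ y. if y = (0::'a) then 1 else x"] by simp
  also have "(\<Sum>y\<in>UNIV. if y = (0::'a) then 1 else x) = 1 + (real CARD('a) - 1) * x"
  proof -
    have "real (card (- {0 :: 'a})) = real CARD('a) - 1"
      by (simp add: Compl_eq_Diff_UNIV card_Diff_singleton of_nat_diff Suc_leI)
    then show ?thesis by (simp add: sum.If_cases)
  qed
  finally show ?thesis by simp
qed

text \<open>Orthogonality of characters: if r is not orthogonal to some v in U, translation by v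
  multiplies the sum by \<open>add_char (r \<bullet> v)\<close>, which differs from 1.\<close>

lemma sum_add_char_subspace:
  fixes U :: "'p::prime_card mod_ring vec set"
  assumes r: "r \<in> carrier_vec n" and U: "is_subspace n U"
  shows "(\<Sum>u\<in>U. add_char (r \<bullet> u)) = of_bool (orth_part r U = U) * of_nat (card U)"
proof (cases "orth_part r U = U")
  case True
  then have "r \<bullet> u = 0" if "u \<in> U" for u using that unfolding orth_part_def by blast
  then have "(\<Sum>u\<in>U. add_char (r \<bullet> u)) = (\<Sum>u\<in>U. 1)"
    by (intro sum.cong) auto
  then show ?thesis using True by simp
next
  case False
  have car: "u \<in> U \<Longrightarrow> u \<in> carrier_vec n" for u using is_subspace_carrier[OF U] by auto
  obtain v where v: "v \<in> U" "r \<bullet> v \<noteq> 0" using False by (auto simp: orth_part_def)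
  have "(\<Sum>u\<in>U. add_char (r \<bullet> u)) = (\<Sum>u\<in>U. add_char (r \<bullet> (u + v)))"
  proof (rule sum.reindex_bij_witness[of _ "\<lambda>u. u + v" "\<lambda>u. u - v"])
    fix u assume u: "u \<in> U"
    show "u - v + v = u" "u + v - v = u" using car[OF u] car[OF v(1)] by (auto intro!: eq_vecI)
    show "u - v \<in> U" "u + v \<in> U" using u v U is_subspace_diff[OF U] by (auto simp: is_subspace_def)
    show "add_char (r \<bullet> (u - v + v)) = add_char (r \<bullet> u)" using \<open>u - v + v = u\<close> by simp
  qed
  also have "\<dots> = (\<Sum>u\<in>U. add_char (r \<bullet> u)) * add_char (r \<bullet> v)"
    unfolding sum_distrib_right using r car v(1)
    by (intro sum.cong refl) (simp add: scalar_prod_add_distrib[of r n] add_char_add)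
  finally have "(\<Sum>u\<in>U. add_char (r \<bullet> u)) = 0" using v(2) add_char_eq_1_iff by auto
  then show ?thesis using False by simp
qed

definition perp_prob :: "nat \<Rightarrow> (nat \<Rightarrow> 'a::{finite,field} \<Rightarrow> real) \<Rightarrow> 'a vec set \<Rightarrow> real" where
  "perp_prob n w U = (\<Sum>r\<in>carrier_vec n. row_prob n w r * of_bool (orth_part r U = U))"

definition char_error :: "nat \<Rightarrow> real \<Rightarrow> 'a::{finite,field} vec set \<Rightarrow> real" where
  "char_error n \<rho> U = (\<Sum>u\<in>U - {0\<^sub>v n}. \<rho> ^ hamming_weight n u) / real (card U)"

text \<open>Times \<open>card U\<close>, the indicator that r is orthogonal to U is a sum of
  characters over U. Exchanging the sums leaves the Fourier transform of the row law at each u in U.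
  The zero vector gives the main term 1; for the others independence yields one factor per
  coordinate, of norm at most \<rho> wherever u is nonzero.\<close>

lemma perp_prob_approx:
  fixes U :: "'p::prime_card mod_ring vec set"
  assumes \<rho>: "char_bound TYPE('p mod_ring) \<alpha> \<rho>" and w: "balanced_row \<alpha> n w" and U: "is_subspace n U"
  shows "\<bar>perp_prob n w U - 1 / real (card U)\<bar> \<le> char_error n \<rho> U"
proof -
  have car: "u \<in> U \<Longrightarrow> u \<in> carrier_vec n" for u using is_subspace_carrier[OF U] by auto
  have fin: "finite U" using finite_is_subspace[OF U] .
  have zU: "0\<^sub>v n \<in> U" using U by (simp add: is_subspace_def)
  have cpos: "0 < real (card U)" using fin zU by (auto simp: card_gt_0_iff)
  define \<phi> where "\<phi> u = (\<Prod>j<n. \<Sum>x\<in>UNIV. of_real (w j x) * add_char (x * (u $ j)))" for u :: "'p mod_ring vec"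
  have "of_real (perp_prob n w U * real (card U)) =
      (\<Sum>r\<in>carrier_vec n. of_real (row_prob n w r) * (\<Sum>u\<in>U. add_char (r \<bullet> u)))"
    unfolding perp_prob_def sum_distrib_right of_real_sum
    using U by (intro sum.cong refl) (simp add: sum_add_char_subspace)
  also have "\<dots> = (\<Sum>u\<in>U. \<Sum>r\<in>carrier_vec n. of_real (row_prob n w r) * add_char (r \<bullet> u))"
    by (subst sum.swap) (simp add: sum_distrib_left)
  also have "\<dots> = (\<Sum>u\<in>U. \<phi> u)"
  proof (intro sum.cong refl)
    fix u assume u: "u \<in> U"
    have "(\<Sum>r\<in>carrier_vec n. of_real (row_prob n w r) * add_char (r \<bullet> u)) =
        (\<Sum>r\<in>carrier_vec n. \<Prod>j<n. of_real (w j (r $ j)) * add_char (r $ j * (u $ j)))"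
      using car[OF u]
      by (intro sum.cong refl) (simp add: row_prob_def scalar_prod_def add_char_sum prod.distrib lessThan_atLeast0)
    then show "(\<Sum>r\<in>carrier_vec n. of_real (row_prob n w r) * add_char (r \<bullet> u)) = \<phi> u"
      unfolding \<phi>_def
      using sum_carrier_vec_prod[where f = "\<lambda>j x. of_real (w j x) * add_char (x * (u $ j))"] by simp
  qed
  also have "\<dots> = \<phi> (0\<^sub>v n) + (\<Sum>u\<in>U - {0\<^sub>v n}. \<phi> u)"
    using fin zU by (simp add: sum.remove)
  also have "\<phi> (0\<^sub>v n) = 1"
  proof -
    have "(\<Sum>x\<in>UNIV. complex_of_real (w j x)) = 1" if "j < n" for j
      using w that by (simp add: balanced_row_def flip: of_real_sum)
    then show ?thesis by (simp add: \<phi>_def)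
  qed
  finally have eq: "complex_of_real (perp_prob n w U * real (card U) - 1) = (\<Sum>u\<in>U - {0\<^sub>v n}. \<phi> u)"
    by simp
  have "\<bar>perp_prob n w U * real (card U) - 1\<bar> = norm (\<Sum>u\<in>U - {0\<^sub>v n}. \<phi> u)"
    unfolding eq[symmetric] norm_of_real by simp
  also have "\<dots> \<le> (\<Sum>u\<in>U - {0\<^sub>v n}. \<rho> ^ hamming_weight n u)"
  proof (rule sum_norm_le)
    fix u assume "u \<in> U - {0\<^sub>v n}"
    have "norm (\<phi> u) \<le> (\<Prod>j<n. if u $ j = 0 then 1 else \<rho>)"
      unfolding \<phi>_def prod_norm[symmetric]
    proof (intro prod_mono conjI norm_ge_zero)
      fix j assume j: "j \<in> {..<n}"
      show "norm (\<Sum>x\<in>UNIV. of_real (w j x) * add_char (x * u $ j)) \<le> (if u $ j = 0 then 1 else \<rho>)"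
      proof (cases "u $ j = 0")
        case True
        then show ?thesis using w j by (simp add: balanced_row_def flip: of_real_sum)
      next
        case False
        then show ?thesis using w j \<rho> by (auto simp: balanced_row_def char_bound_def)
      qed
    qed
    also have "\<dots> = \<rho> ^ hamming_weight n u"
      by (simp add: hamming_weight_def prod.If_cases Int_def Collect_neg_eq[symmetric] set_diff_eq)
    finally show "norm (\<phi> u) \<le> \<rho> ^ hamming_weight n u" .
  qed
  finally have "\<bar>perp_prob n w U * real (card U) - 1\<bar> / real (card U) \<le> char_error n \<rho> U"
    using cpos by (simp add: char_error_def divide_right_mono)
  moreover have "perp_prob n w U - 1 / real (card U) = (perp_prob n w U * real (card U) - 1) / real (card U)"
    using cpos by (simp add: field_simps)
  ultimately show ?thesis using cpos by (simp add: abs_divide)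
qed

section \<open>Revealing rows one at a time\<close>

text \<open>Expectation of F at the space orthogonal to the rows 0, ..., k - 1. The last row is
  averaged inside F, so conditioning on the earlier rows is the defining equation and no law on the
  set of subspaces has to be built.\<close>

primrec row_expect :: "nat \<Rightarrow> (nat \<Rightarrow> nat \<Rightarrow> 'a::{finite,field} \<Rightarrow> real) \<Rightarrow> nat \<Rightarrow> ('a vec set \<Rightarrow> real) \<Rightarrow> real" where
  "row_expect n w 0 F = F (carrier_vec n)"
| "row_expect n w (Suc k) F =
     row_expect n w k (\<lambda>U. \<Sum>r\<in>carrier_vec n. row_prob n (w k) r * F (orth_part r U))"

text \<open>The state \<open>(s, e)\<close> stands for \<open>dim U = s + e\<close> and \<open>dim (U \<inter> H) = e\<close>; the value is the probability
  that \<open>t\<close> further uniform rows lead to \<open>(i, j)\<close>, where \<open>q\<close> is the inverse of the field size. The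
  truncated subtractions at \<open>s = 0\<close> and \<open>e = 0\<close> have coefficient zero.\<close>

primrec dim_chain :: "real \<Rightarrow> nat \<Rightarrow> nat \<Rightarrow> nat \<Rightarrow> nat \<Rightarrow> nat \<Rightarrow> real" where
  "dim_chain q i j 0 s e = of_bool (s = i \<and> e = j)"
| "dim_chain q i j (Suc t) s e = q ^ (s + e) * dim_chain q i j t s e
     + (q ^ e - q ^ (s + e)) * dim_chain q i j t (s - 1) e + (1 - q ^ e) * dim_chain q i j t s (e - 1)"

lemma dim_chain_bounds:
  assumes "0 \<le> q" "q \<le> 1"
  shows "0 \<le> dim_chain q i j t s e \<and> dim_chain q i j t s e \<le> 1"
proof (induction t arbitrary: s e)
  case (Suc t)
  have c: "0 \<le> q ^ (s + e)" "0 \<le> q ^ e - q ^ (s + e)" "0 \<le> 1 - q ^ e"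
    using assms power_decreasing[of e "s + e" q] by (auto simp: power_le_one)
  have "dim_chain q i j (Suc t) s e \<le> q ^ (s + e) * 1 + (q ^ e - q ^ (s + e)) * 1 + (1 - q ^ e) * 1"
    unfolding dim_chain.simps using Suc c by (intro add_mono mult_left_mono) auto
  then show ?case using Suc c by (auto intro!: add_nonneg_nonneg mult_nonneg_nonneg)
qed auto

text \<open>For a subspace this is the dimension; it is unspecified unless \<open>card U\<close> is a power of the field size.\<close>

definition log_card :: "'a::finite vec set \<Rightarrow> nat" where
  "log_card U = (THE d. card U = CARD('a) ^ d)"

lemma log_card_eq: "card (U :: 'a::{finite,field} vec set) = CARD('a) ^ d \<Longrightarrow> log_card U = d"
  unfolding log_card_def using card_field_gt_1[where 'a = 'a] by (intro the_equality) auto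

text \<open>Of the entry laws only nonnegativity, total mass and the Fourier bound are kept; the
  analysis of the chain is then free of characters and valid over every finite field.\<close>

locale row_chain =
  fixes n :: nat and w :: "nat \<Rightarrow> nat \<Rightarrow> 'a::{finite,field} \<Rightarrow> real" and \<rho> q :: real
  assumes q: "q = 1 / real CARD('a)"
    and row_nonneg: "\<And>k r. k < n \<Longrightarrow> 0 \<le> row_prob n (w k) r"
    and row_sum: "\<And>k. k < n \<Longrightarrow> (\<Sum>r\<in>carrier_vec n. row_prob n (w k) r) = 1"
    and perp_approx: "\<And>k U. k < n \<Longrightarrow> is_subspace n U \<Longrightarrow>
          \<bar>perp_prob n (w k) U - 1 / real (card U)\<bar> \<le> char_error n \<rho> U"
    and rho: "0 < \<rho>" "\<rho> < 1"
begin

abbreviation \<beta> :: real where "\<beta> \<equiv> q + (1 - q) * \<rho>"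

lemma q_bounds: "0 < q" "q < 1"
  using card_field_gt_1[where 'a = 'a] by (auto simp: q)

lemma beta_bounds: "q \<le> \<beta>" "\<beta> < 1" "0 < \<beta>"
proof -
  show 1: "q \<le> \<beta>" using rho q_bounds by simp
  have "(1 - q) * \<rho> < (1 - q) * 1" using rho q_bounds by (intro mult_strict_left_mono) auto
  then show "\<beta> < 1" by simp
  show "0 < \<beta>" using 1 q_bounds by linarith
qed

lemma row_expect_add: "row_expect n w k (\<lambda>U. F U + G U) = row_expect n w k F + row_expect n w k G"
proof (induction k arbitrary: F G)
  case (Suc k)
  show ?case by (simp add: algebra_simps sum.distrib Suc)
qed simp

lemma row_expect_cmult: "row_expect n w k (\<lambda>U. c * F U) = c * row_expect n w k F"
proof (induction k arbitrary: F)
  case (Suc k)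
  have "(\<lambda>U. \<Sum>r\<in>carrier_vec n. row_prob n (w k) r * (c * F (orth_part r U))) =
        (\<lambda>U. c * (\<Sum>r\<in>carrier_vec n. row_prob n (w k) r * F (orth_part r U)))"
    by (simp add: sum_distrib_left algebra_simps)
  then show ?case by (simp add: Suc)
qed simp

lemma row_expect_diff: "row_expect n w k (\<lambda>U. F U - G U) = row_expect n w k F - row_expect n w k G"
  using row_expect_add[of k F "\<lambda>U. (-1) * G U"] row_expect_cmult[of k "-1" G] by simp

lemma row_expect_const: "k \<le> n \<Longrightarrow> row_expect n w k (\<lambda>_. c) = c"
proof (induction k)
  case (Suc k)
  then show ?case using row_sum[of k] by (simp flip: sum_distrib_right)
qed simp

lemma row_expect_sum:
  "row_expect n w k (\<lambda>U. \<Sum>x\<in>A. F x U) = (\<Sum>x\<in>A. row_expect n w k (F x))"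
proof (induction A rule: infinite_finite_induct)
  case (infinite A)
  then show ?case using row_expect_cmult[of k 0 "\<lambda>_. 0"] by simp
next
  case empty
  then show ?case using row_expect_cmult[of k 0 "\<lambda>_. 0"] by simp
next
  case (insert x A)
  then show ?case by (simp add: row_expect_add)
qed

lemma orth_part_line:
  assumes r: "r \<in> carrier_vec n" and u: "u \<in> carrier_vec n"
  shows "orth_part r (range (\<lambda>c. c \<cdot>\<^sub>v u)) = range (\<lambda>c. c \<cdot>\<^sub>v u) \<longleftrightarrow> r \<bullet> u = (0::'a)"
proof
  assume c: "orth_part r (range (\<lambda>c. c \<cdot>\<^sub>v u)) = range (\<lambda>c. c \<cdot>\<^sub>v u)"
  have "1 \<cdot>\<^sub>v u \<in> range (\<lambda>c. c \<cdot>\<^sub>v u)" by blast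
  then have "1 \<cdot>\<^sub>v u \<in> orth_part r (range (\<lambda>c. c \<cdot>\<^sub>v u))" using c by simp
  then show "r \<bullet> u = 0" by (simp add: orth_part_def)
next
  assume "r \<bullet> u = 0"
  then show "orth_part r (range (\<lambda>c. c \<cdot>\<^sub>v u)) = range (\<lambda>c. c \<cdot>\<^sub>v u)"
    using r u by (auto simp: orth_part_def)
qed

text \<open>Origin of \<beta>: \<open>perp_approx\<close> is applied to the line through u. Its main
  term is q, and each of the \<open>CARD('a) - 1\<close> nonzero multiples has weight at least 1, so
  they contribute at most (1 - q) * \<rho>.\<close>

lemma perp_vec_le:
  assumes k: "k < n" and u: "u \<in> carrier_vec n" "u \<noteq> 0\<^sub>v n"
  shows "(\<Sum>r\<in>carrier_vec n. row_prob n (w k) r * of_bool (r \<bullet> u = 0)) \<le> \<beta>"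
proof -
  define L where "L = range (\<lambda>c. c \<cdot>\<^sub>v u)"
  obtain i where i: "i < n" "u $ i \<noteq> 0" using u by (metis carrier_vecD eq_vecI index_zero_vec)
  have L: "is_subspace n L"
  proof -
    have "0\<^sub>v n \<in> range (\<lambda>c. c \<cdot>\<^sub>v u)" using u by (intro image_eqI[of _ _ 0]) auto
    then show ?thesis using u unfolding is_subspace_def L_def
      by (auto simp: image_iff smult_smult_assoc simp flip: add_smult_distrib_vec)
  qed
  have inj: "inj (\<lambda>c. c \<cdot>\<^sub>v u)"
  proof (rule injI)
    fix c d assume "c \<cdot>\<^sub>v u = d \<cdot>\<^sub>v u"
    then have "(c \<cdot>\<^sub>v u) $ i = (d \<cdot>\<^sub>v u) $ i" by simp
    then show "c = d" using i u by simp
  qed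
  have cardL: "card L = CARD('a)" unfolding L_def using inj by (rule card_image)
  have zL: "0\<^sub>v n \<in> L" and finL: "finite L" using L by (auto simp: is_subspace_def L_def)
  have "(\<Sum>v\<in>L - {0\<^sub>v n}. \<rho> ^ hamming_weight n v) \<le> (\<Sum>v\<in>L - {0\<^sub>v n}. \<rho>)"
  proof (rule sum_mono)
    fix v assume v: "v \<in> L - {0\<^sub>v n}"
    then have "v \<in> carrier_vec n" "v \<noteq> 0\<^sub>v n" using L by (auto simp: is_subspace_def)
    then obtain i where "i < n" "v $ i \<noteq> 0" by (metis carrier_vecD eq_vecI index_zero_vec)
    then have "{j \<in> {..<n}. v $ j \<noteq> 0} \<noteq> {}" by auto
    then have "1 \<le> hamming_weight n v" by (simp add: hamming_weight_def Suc_le_eq card_gt_0_iff)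
    then show "\<rho> ^ hamming_weight n v \<le> \<rho>" using rho power_decreasing[of 1 "hamming_weight n v" \<rho>] by simp
  qed
  also have "\<dots> = (real CARD('a) - 1) * \<rho>"
    using zL finL cardL card_field_gt_1[where 'a = 'a] by (simp add: card_Diff_singleton of_nat_diff)
  finally have "char_error n \<rho> L \<le> (real CARD('a) - 1) * \<rho> / real CARD('a)"
    unfolding char_error_def cardL by (rule divide_right_mono) simp
  also have "\<dots> = (1 - q) * \<rho>" by (simp add: q field_simps)
  finally have "perp_prob n (w k) L \<le> \<beta>"
    using perp_approx[OF k L] cardL by (simp add: abs_le_iff q)
  moreover have "perp_prob n (w k) L = (\<Sum>r\<in>carrier_vec n. row_prob n (w k) r * of_bool (r \<bullet> u = 0))"
    unfolding perp_prob_def L_def using orth_part_line u by (intro sum.cong) auto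
  ultimately show ?thesis by simp
qed

end

section \<open>The chain relative to a fixed subspace\<close>

locale row_chain_subspace = row_chain n w \<rho> q
  for n :: nat and w :: "nat \<Rightarrow> nat \<Rightarrow> 'a::{finite,field} \<Rightarrow> real" and \<rho> q :: real +
  fixes H :: "'a vec set" and b :: nat
  assumes H: "is_subspace n H" and b: "b \<le> n" and cardH: "card H = CARD('a) ^ (n - b)"
begin

text \<open>Invariant of every space met after k rows: each row lowers either dimension by at most
  one, from n and n - b respectively. It also records that both cardinalities are powers of the
  field size, which makes \<open>log_card\<close> meaningful.\<close>

definition reach :: "nat \<Rightarrow> 'a vec set \<Rightarrow> bool" where
  "reach k U \<longleftrightarrow> is_subspace n U \<and> (\<exists>s e. card U = CARD('a) ^ (s + e) \<and>
     card (U \<inter> H) = CARD('a) ^ e \<and> n \<le> s + e + k \<and> n \<le> e + b + k)"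

lemma reachI:
  "is_subspace n U \<Longrightarrow> card U = CARD('a) ^ (s + e) \<Longrightarrow> card (U \<inter> H) = CARD('a) ^ e \<Longrightarrow>
    n \<le> s + e + k \<Longrightarrow> n \<le> e + b + k \<Longrightarrow> reach k U"
  unfolding reach_def by blast

lemma reach_0: "reach 0 (carrier_vec n)"
proof -
  have "carrier_vec n \<inter> H = H" using H by (auto simp: is_subspace_def)
  then show ?thesis using cardH b is_subspace_carrier_vec
    by (intro reachI[of _ b "n - b"]) (auto simp: card_carrier_vec)
qed

lemma power_card_cancel:
  assumes "CARD('a) ^ d = CARD('a) * m"
  obtains d' where "d = Suc d'" "m = CARD('a) ^ d'"
proof (cases d)
  case 0
  then have "CARD('a) * m = 1" using assms by simp
  then show ?thesis using card_field_gt_1[where 'a = 'a] by simp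
next
  case (Suc d')
  then show ?thesis using assms that by simp
qed

text \<open>A row orthogonal to U is orthogonal to \<open>U \<inter> H\<close>, so only three of
  four combinations occur. In the outer case \<open>U \<inter> H\<close> lies in the smaller space,
  which forces s > 0; in the inner case both dimensions drop, so s is unchanged.\<close>

lemma orth_part_cases:
  assumes U: "is_subspace n U" and r: "r \<in> carrier_vec n"
    and c: "card U = CARD('a) ^ (s + e)" "card (U \<inter> H) = CARD('a) ^ e"
  obtains (stay) "orth_part r U = U" "orth_part r (U \<inter> H) = U \<inter> H"
  | (outer) s' where "s = Suc s'" "orth_part r U \<noteq> U" "orth_part r (U \<inter> H) = U \<inter> H"
      "card (orth_part r U) = CARD('a) ^ (s' + e)"
  | (inner) e' where "e = Suc e'" "orth_part r U \<noteq> U" "orth_part r (U \<inter> H) \<noteq> U \<inter> H"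
      "card (orth_part r U) = CARD('a) ^ (s + e')" "card (orth_part r U \<inter> H) = CARD('a) ^ e'"
proof (cases "orth_part r U = U")
  case True
  then have "orth_part r (U \<inter> H) = U \<inter> H" by (simp add: orth_part_Int)
  then show ?thesis using True stay by blast
next
  case ne: False
  have UH: "is_subspace n (U \<inter> H)" using U H by (rule is_subspace_Int)
  have eq: "CARD('a) ^ (s + e) = CARD('a) * card (orth_part r U)" using card_orth_part[OF r U ne] c by simp
  show ?thesis
  proof (cases "orth_part r (U \<inter> H) = U \<inter> H")
    case True
    obtain d where d: "s + e = Suc d" "card (orth_part r U) = CARD('a) ^ d"
      using power_card_cancel[OF eq] by metis
    have "U \<inter> H \<subseteq> orth_part r U" using True by (auto simp: orth_part_Int)
    then have "CARD('a) ^ e \<le> CARD('a) ^ d"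
      using card_mono[of "orth_part r U" "U \<inter> H"] finite_is_subspace[OF is_subspace_orth_part[OF r U]] c d by simp
    then have "e \<le> d" using card_field_gt_1[where 'a = 'a] by (meson power_le_imp_le_exp)
    then have "s = Suc (d - e)" "d = (d - e) + e" using d by auto
    then show ?thesis using outer[of "d - e"] ne True d by metis
  next
    case False
    have eq2: "CARD('a) ^ e = CARD('a) * card (orth_part r (U \<inter> H))" using card_orth_part[OF r UH False] c by simp
    obtain e' where e': "e = Suc e'" "card (orth_part r (U \<inter> H)) = CARD('a) ^ e'"
      using power_card_cancel[OF eq2] by metis
    have "card (orth_part r U) = CARD('a) ^ (s + e')" using eq e' card_field_gt_1[where 'a = 'a] by simp
    then show ?thesis using inner[of e'] ne False e' by (simp add: orth_part_Int)
  qed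
qed

lemma reach_orth_part:
  assumes "reach k U" and r: "r \<in> carrier_vec n"
  shows "reach (Suc k) (orth_part r U)"
proof -
  from assms obtain s e where U: "is_subspace n U"
    and c: "card U = CARD('a) ^ (s + e)" "card (U \<inter> H) = CARD('a) ^ e"
    and le: "n \<le> s + e + k" "n \<le> e + b + k" by (auto simp: reach_def)
  have sub: "is_subspace n (orth_part r U)" using is_subspace_orth_part[OF r U] .
  from U r c show ?thesis
  proof (cases rule: orth_part_cases)
    case stay
    then show ?thesis using sub c le by (intro reachI[of _ s e]) auto
  next
    case (outer s')
    then show ?thesis using sub c le by (intro reachI[of _ s' e]) (auto simp flip: orth_part_Int)
  next
    case (inner e')
    then show ?thesis using sub c le by (intro reachI[of _ s e']) auto
  qed
qed

lemma row_expect_mono: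
  assumes "k \<le> n" "\<And>U. reach k U \<Longrightarrow> F U \<le> G U"
  shows "row_expect n w k F \<le> row_expect n w k G"
  using assms
proof (induction k arbitrary: F G)
  case 0
  then show ?case using reach_0 by simp
next
  case (Suc k)
  have "row_expect n w k (\<lambda>U. \<Sum>r\<in>carrier_vec n. row_prob n (w k) r * F (orth_part r U)) \<le>
        row_expect n w k (\<lambda>U. \<Sum>r\<in>carrier_vec n. row_prob n (w k) r * G (orth_part r U))"
  proof (rule Suc.IH)
    fix U assume "reach k U"
    then show "(\<Sum>r\<in>carrier_vec n. row_prob n (w k) r * F (orth_part r U)) \<le>
        (\<Sum>r\<in>carrier_vec n. row_prob n (w k) r * G (orth_part r U))"
      using Suc.prems reach_orth_part row_nonneg by (intro sum_mono mult_left_mono) auto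
  qed (use Suc.prems in auto)
  then show ?case by simp
qed

lemma row_expect_abs:
  assumes "k \<le> n"
  shows "\<bar>row_expect n w k F\<bar> \<le> row_expect n w k (\<lambda>U. \<bar>F U\<bar>)"
  using row_expect_mono[OF assms, of F "\<lambda>U. \<bar>F U\<bar>"] row_expect_mono[OF assms, of "\<lambda>U. (-1) * F U" "\<lambda>U. \<bar>F U\<bar>"]
    row_expect_cmult[of k "-1" F] by (simp add: abs_le_iff)

lemma row_expect_mem_le:
  assumes "k \<le> n" and u: "u \<in> carrier_vec n" "u \<noteq> 0\<^sub>v n"
  shows "row_expect n w k (\<lambda>U. of_bool (u \<in> U)) \<le> \<beta> ^ k"
  using assms(1)
proof (induction k)
  case 0
  then show ?case using u by simp
next
  case (Suc k)
  have "row_expect n w (Suc k) (\<lambda>U. of_bool (u \<in> U)) \<le> row_expect n w k (\<lambda>U. \<beta> * of_bool (u \<in> U))"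
    unfolding row_expect.simps
  proof (rule row_expect_mono)
    fix U
    have "(\<Sum>r\<in>carrier_vec n. row_prob n (w k) r * of_bool (u \<in> orth_part r U)) =
        of_bool (u \<in> U) * (\<Sum>r\<in>carrier_vec n. row_prob n (w k) r * of_bool (r \<bullet> u = 0))"
      by (auto simp: orth_part_def)
    also have "\<dots> \<le> of_bool (u \<in> U) * \<beta>"
      using perp_vec_le[OF _ u, of k] Suc.prems by (intro mult_left_mono) auto
    finally show "(\<Sum>r\<in>carrier_vec n. row_prob n (w k) r * of_bool (u \<in> orth_part r U)) \<le> \<beta> * of_bool (u \<in> U)"
      by (simp add: mult.commute)
  qed (use Suc.prems in simp)
  also have "\<dots> = \<beta> * row_expect n w k (\<lambda>U. of_bool (u \<in> U))"
    by (rule row_expect_cmult)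
  also have "\<dots> \<le> \<beta> * \<beta> ^ k"
    using Suc beta_bounds by (intro mult_left_mono) auto
  finally show ?case by simp
qed

end

section \<open>Comparison with uniform rows\<close>

context row_chain_subspace
begin

definition state_value :: "(nat \<Rightarrow> nat \<Rightarrow> real) \<Rightarrow> 'a vec set \<Rightarrow> real" where
  "state_value f U = f (log_card U - log_card (U \<inter> H)) (log_card (U \<inter> H))"

lemma state_value_eq:
  "card U = CARD('a) ^ (s + e) \<Longrightarrow> card (U \<inter> H) = CARD('a) ^ e \<Longrightarrow> state_value f U = f s e"
  by (simp add: state_value_def log_card_eq[of U "s + e"] log_card_eq[of "U \<inter> H" e])

text \<open>The two orthogonality events are nested, so the value after one row is a combination of
  their indicators; A, B, C are the values if nothing, only the dimension of U, or both dimensions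
  drop. The mean differs from the uniform step only through the two probabilities, with coefficients
  A - B and B - C of absolute value at most 1.\<close>

lemma row_step_approx:
  assumes k: "k < n" and U: "reach k U"
  shows "\<bar>(\<Sum>r\<in>carrier_vec n. row_prob n (w k) r * state_value (dim_chain q i j t) (orth_part r U)) -
      state_value (dim_chain q i j (Suc t)) U\<bar> \<le> char_error n \<rho> U + char_error n \<rho> (U \<inter> H)"
proof -
  from U obtain s e where sub: "is_subspace n U"
    and c: "card U = CARD('a) ^ (s + e)" "card (U \<inter> H) = CARD('a) ^ e" by (auto simp: reach_def)
  have subH: "is_subspace n (U \<inter> H)" using sub H by (rule is_subspace_Int)
  define p1 where "p1 = perp_prob n (w k) U"
  define p2 where "p2 = perp_prob n (w k) (U \<inter> H)"
  define A B C where "A = dim_chain q i j t s e" and "B = dim_chain q i j t (s - 1) e" and "C = dim_chain q i j t s (e - 1)"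
  have val: "state_value (dim_chain q i j t) (orth_part r U) =
      of_bool (orth_part r U = U) * (A - B) + of_bool (orth_part r (U \<inter> H) = U \<inter> H) * (B - C) + C"
    if r: "r \<in> carrier_vec n" for r
    using sub r c
  proof (cases rule: orth_part_cases)
    case stay
    then show ?thesis using c by (simp add: state_value_eq A_def)
  next
    case (outer s')
    then have "state_value (dim_chain q i j t) (orth_part r U) = dim_chain q i j t s' e"
      using c by (intro state_value_eq) (auto simp flip: orth_part_Int)
    then show ?thesis using outer by (simp add: B_def)
  next
    case (inner e')
    then show ?thesis using c by (simp add: state_value_eq[of _ s e'] C_def)
  qed
  have "(\<Sum>r\<in>carrier_vec n. row_prob n (w k) r * state_value (dim_chain q i j t) (orth_part r U)) =
     (\<Sum>r\<in>carrier_vec n. row_prob n (w k) r * of_bool (orth_part r U = U) * (A - B)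
        + row_prob n (w k) r * of_bool (orth_part r (U \<inter> H) = U \<inter> H) * (B - C) + row_prob n (w k) r * C)"
    by (intro sum.cong refl) (simp add: val distrib_left mult.assoc)
  also have "\<dots> = p1 * (A - B) + p2 * (B - C) + C"
    unfolding sum.distrib sum_distrib_right[symmetric] p1_def p2_def perp_prob_def row_sum[OF k] by simp
  finally have "(\<Sum>r\<in>carrier_vec n. row_prob n (w k) r * state_value (dim_chain q i j t) (orth_part r U)) -
      state_value (dim_chain q i j (Suc t)) U = (p1 - q ^ (s + e)) * (A - B) + (p2 - q ^ e) * (B - C)"
    using c by (simp add: state_value_eq[of _ s e] A_def B_def C_def algebra_simps)
  also have "\<bar>\<dots>\<bar> \<le> \<bar>p1 - q ^ (s + e)\<bar> * \<bar>A - B\<bar> + \<bar>p2 - q ^ e\<bar> * \<bar>B - C\<bar>"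
    by (rule order_trans[OF abs_triangle_ineq]) (simp add: abs_mult)
  also have "\<dots> \<le> char_error n \<rho> U * 1 + char_error n \<rho> (U \<inter> H) * 1"
  proof -
    have "0 \<le> A \<and> A \<le> 1" "0 \<le> B \<and> B \<le> 1" "0 \<le> C \<and> C \<le> 1"
      unfolding A_def B_def C_def using q_bounds by (auto intro!: dim_chain_bounds)
    then have "\<bar>A - B\<bar> \<le> 1" "\<bar>B - C\<bar> \<le> 1" by auto
    moreover have "\<bar>p1 - q ^ (s + e)\<bar> \<le> char_error n \<rho> U"
      using perp_approx[OF k sub] c by (simp add: p1_def q power_one_over)
    moreover have "\<bar>p2 - q ^ e\<bar> \<le> char_error n \<rho> (U \<inter> H)"
      using perp_approx[OF k subH] c by (simp add: p2_def q power_one_over)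
    ultimately show ?thesis by (intro add_mono mult_mono) auto
  qed
  finally show ?thesis by simp
qed

text \<open>Replacement of one row at a time: the k-th mixed model has k actual rows followed by n -
  k uniform ones, whose effect is \<open>dim_chain\<close>. Neighbouring models differ in a single
  row, and k = 0 is the uniform chain started at (b, n - b).\<close>

lemma row_expect_telescope:
  assumes "k \<le> n"
  shows "\<bar>row_expect n w k (state_value (dim_chain q i j (n - k))) - dim_chain q i j n b (n - b)\<bar>
    \<le> (\<Sum>l<k. row_expect n w l (\<lambda>U. char_error n \<rho> U + char_error n \<rho> (U \<inter> H)))"
  using assms
proof (induction k)
  case 0
  have "carrier_vec n \<inter> H = H" using H by (auto simp: is_subspace_def)
  then show ?case using cardH b by (simp add: state_value_eq[of _ b "n - b"] card_carrier_vec)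
next
  case (Suc k)
  then have k: "k < n" by simp
  then have nk: "n - k = Suc (n - Suc k)" by simp
  let ?D = "\<lambda>U. (\<Sum>r\<in>carrier_vec n. row_prob n (w k) r * state_value (dim_chain q i j (n - Suc k)) (orth_part r U))
      - state_value (dim_chain q i j (n - k)) U"
  have "\<bar>row_expect n w (Suc k) (state_value (dim_chain q i j (n - Suc k))) -
      row_expect n w k (state_value (dim_chain q i j (n - k)))\<bar> = \<bar>row_expect n w k ?D\<bar>"
    by (simp add: row_expect_diff)
  also have "\<dots> \<le> row_expect n w k (\<lambda>U. \<bar>?D U\<bar>)"
    using k by (intro row_expect_abs) simp
  also have "\<dots> \<le> row_expect n w k (\<lambda>U. char_error n \<rho> U + char_error n \<rho> (U \<inter> H))"
    using k row_step_approx[OF k] unfolding nk by (intro row_expect_mono) auto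
  finally show ?case using Suc.IH k unfolding sum.lessThan_Suc by linarith
qed

section \<open>Expected Fourier errors\<close>

text \<open>X will be U or \<open>U \<inter> H\<close>. The numerator is enlarged to a sum over a
  fixed set with indicators of \<open>u \<in> U\<close>, whose expectations
  \<open>row_expect_mem_le\<close> bounds; \<mu> and m stay free for the balance between light and
  heavy vectors.\<close>

lemma char_error_le:
  assumes X: "is_subspace n X" and XU: "X \<subseteq> U" and \<mu>: "0 < \<mu>" "\<mu> \<le> 1"
  shows "char_error n \<rho> X \<le> \<rho> ^ m +
    (\<Sum>u\<in>carrier_vec n - {0\<^sub>v n}. \<mu> ^ hamming_weight n u * of_bool (u \<in> U)) / (\<mu> ^ m * real (card X))"
proof -
  have fin: "finite X" using finite_is_subspace[OF X] .
  have zX: "0\<^sub>v n \<in> X" and XC: "X \<subseteq> carrier_vec n" using X by (auto simp: is_subspace_def)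
  have cpos: "0 < real (card X)" using fin zX by (auto simp: card_gt_0_iff)
  \<comment> \<open>weights below \<open>m\<close> are charged to \<open>\<mu> ^ weight\<close>, whose sum over the whole space factorises\<close>
  have pt: "\<rho> ^ l \<le> \<rho> ^ m + \<mu> ^ l / \<mu> ^ m" for l
  proof (cases "m \<le> l")
    case True
    then have "\<rho> ^ l \<le> \<rho> ^ m" using rho by (intro power_decreasing) auto
    then show ?thesis using \<mu> by (simp add: add_increasing2)
  next
    case False
    then have "\<mu> ^ m \<le> \<mu> ^ l" using \<mu> by (intro power_decreasing) auto
    then have "1 \<le> \<mu> ^ l / \<mu> ^ m" using \<mu> by simp
    moreover have "\<rho> ^ l \<le> 1" "0 \<le> \<rho> ^ m" using rho by (auto simp: power_le_one)
    ultimately show ?thesis by linarith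
  qed
  have "(\<Sum>u\<in>X - {0\<^sub>v n}. \<rho> ^ hamming_weight n u) \<le> (\<Sum>u\<in>X - {0\<^sub>v n}. \<rho> ^ m + \<mu> ^ hamming_weight n u / \<mu> ^ m)"
    by (intro sum_mono pt)
  also have "\<dots> = real (card (X - {0\<^sub>v n})) * \<rho> ^ m + (\<Sum>u\<in>X - {0\<^sub>v n}. \<mu> ^ hamming_weight n u) / \<mu> ^ m"
    by (simp add: sum.distrib sum_divide_distrib)
  also have "\<dots> \<le> real (card X) * \<rho> ^ m +
      (\<Sum>u\<in>carrier_vec n - {0\<^sub>v n}. \<mu> ^ hamming_weight n u * of_bool (u \<in> U)) / \<mu> ^ m"
  proof (intro add_mono divide_right_mono mult_right_mono)
    show "real (card (X - {0\<^sub>v n})) \<le> real (card X)" using fin by (simp add: card_mono)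
    have "(\<Sum>u\<in>X - {0\<^sub>v n}. \<mu> ^ hamming_weight n u) = (\<Sum>u\<in>X - {0\<^sub>v n}. \<mu> ^ hamming_weight n u * of_bool (u \<in> U))"
      using XU by (intro sum.cong) auto
    also have "\<dots> \<le> (\<Sum>u\<in>carrier_vec n - {0\<^sub>v n}. \<mu> ^ hamming_weight n u * of_bool (u \<in> U))"
      using XC \<mu> by (intro sum_mono2) auto
    finally show "(\<Sum>u\<in>X - {0\<^sub>v n}. \<mu> ^ hamming_weight n u) \<le>
      (\<Sum>u\<in>carrier_vec n - {0\<^sub>v n}. \<mu> ^ hamming_weight n u * of_bool (u \<in> U))" .
  qed (use rho \<mu> in auto)
  finally have "char_error n \<rho> X \<le> (real (card X) * \<rho> ^ m +
      (\<Sum>u\<in>carrier_vec n - {0\<^sub>v n}. \<mu> ^ hamming_weight n u * of_bool (u \<in> U)) / \<mu> ^ m) / real (card X)"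
    unfolding char_error_def by (rule divide_right_mono) simp
  also have "\<dots> = \<rho> ^ m +
    (\<Sum>u\<in>carrier_vec n - {0\<^sub>v n}. \<mu> ^ hamming_weight n u * of_bool (u \<in> U)) / (\<mu> ^ m * real (card X))"
    using cpos \<mu> by (simp add: field_simps)
  finally show ?thesis .
qed

lemma sum_hamming_weight_nonzero_le:
  assumes "0 \<le> \<mu>"
  shows "(\<Sum>u\<in>carrier_vec n - {0\<^sub>v n :: 'a vec}. \<mu> ^ hamming_weight n u) \<le> (1 + (real CARD('a) - 1) * \<mu>) ^ n"
  unfolding sum_hamming_weight[symmetric] using assms by (intro sum_mono2) auto

text \<open>If \<open>n \<le> 2 * k\<close>, survival gives the factor \<open>\<beta> ^ k\<close>.
  Otherwise division by the cardinality of X U, a space of dimension at least n - k - b, gives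
  \<open>q ^ (n - k)\<close> at the price of \<open>CARD('a) ^ b\<close>. Since
  \<open>q \<le> \<beta>\<close>, both factors are at most \<open>sqrt \<beta> ^ n\<close>.\<close>

lemma row_expect_char_error_le:
  assumes k: "k < n" and \<mu>: "0 < \<mu>" "\<mu> \<le> 1"
    and X: "\<And>U. reach k U \<Longrightarrow> is_subspace n (X U) \<and> X U \<subseteq> U \<and>
      CARD('a) ^ n \<le> CARD('a) ^ (b + k) * card (X U)"
  shows "row_expect n w k (\<lambda>U. char_error n \<rho> (X U)) \<le>
    \<rho> ^ m + real CARD('a) ^ b * ((1 + (real CARD('a) - 1) * \<mu>) * sqrt \<beta>) ^ n / \<mu> ^ m"
proof -
  define T where "T = (1 + (real CARD('a) - 1) * \<mu>) ^ n"
  define Z where "Z U = (\<Sum>u\<in>carrier_vec n - {0\<^sub>v n}. \<mu> ^ hamming_weight n u * of_bool (u \<in> U))" for U :: "'a vec set"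
  have ca: "1 \<le> real CARD('a)" using card_field_gt_1[where 'a = 'a] by simp
  have T0: "0 \<le> T" unfolding T_def using \<mu> ca by (intro zero_le_power add_nonneg_nonneg mult_nonneg_nonneg) auto
  have Z0: "0 \<le> Z U" for U unfolding Z_def using \<mu> by (intro sum_nonneg) auto
  have ZT: "Z U \<le> T" for U
  proof -
    have "Z U \<le> (\<Sum>u\<in>carrier_vec n - {0\<^sub>v n :: 'a vec}. \<mu> ^ hamming_weight n u)"
      unfolding Z_def using \<mu> by (intro sum_mono) (auto simp: mult_left_le)
    then show ?thesis using sum_hamming_weight_nonzero_le[of \<mu>] \<mu> unfolding T_def by linarith
  qed
  have EZ: "row_expect n w k Z \<le> \<beta> ^ k * T"
  proof -
    have "row_expect n w k Z =
        (\<Sum>u\<in>carrier_vec n - {0\<^sub>v n}. \<mu> ^ hamming_weight n u * row_expect n w k (\<lambda>U. of_bool (u \<in> U)))"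
      unfolding Z_def by (simp only: row_expect_sum row_expect_cmult)
    also have "\<dots> \<le> (\<Sum>u\<in>carrier_vec n - {0\<^sub>v n :: 'a vec}. \<mu> ^ hamming_weight n u * \<beta> ^ k)"
      using k \<mu> by (intro sum_mono mult_left_mono row_expect_mem_le) auto
    also have "\<dots> = \<beta> ^ k * (\<Sum>u\<in>carrier_vec n - {0\<^sub>v n :: 'a vec}. \<mu> ^ hamming_weight n u)"
      by (simp add: sum_distrib_left mult.commute)
    also have "\<dots> \<le> \<beta> ^ k * T"
      unfolding T_def using \<mu> beta_bounds by (intro mult_left_mono sum_hamming_weight_nonzero_le) auto
    finally show ?thesis .
  qed
  \<comment> \<open>Common frame of both regimes: late rows use F = Z with
    \<open>c = \<beta> ^ k\<close>, early rows a constant F with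
    \<open>c = q ^ (n - k)\<close>.\<close>
  have E: "row_expect n w k (\<lambda>U. char_error n \<rho> (X U)) \<le> \<rho> ^ m + real CARD('a) ^ b * (c * T) / \<mu> ^ m"
    if "\<And>U. reach k U \<Longrightarrow> Z U / real (card (X U)) \<le> F U" "row_expect n w k F \<le> real CARD('a) ^ b * (c * T)" for F c
  proof -
    have "row_expect n w k (\<lambda>U. char_error n \<rho> (X U)) \<le> row_expect n w k (\<lambda>U. \<rho> ^ m + (1 / \<mu> ^ m) * F U)"
    proof (rule row_expect_mono)
      fix U assume U: "reach k U"
      have "char_error n \<rho> (X U) \<le> \<rho> ^ m + Z U / (\<mu> ^ m * real (card (X U)))"
        unfolding Z_def using X[OF U] \<mu> by (intro char_error_le) auto
      also have "Z U / (\<mu> ^ m * real (card (X U))) = (1 / \<mu> ^ m) * (Z U / real (card (X U)))" by simp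
      also have "\<dots> \<le> (1 / \<mu> ^ m) * F U" using that(1)[OF U] \<mu> by (intro mult_left_mono) auto
      finally show "char_error n \<rho> (X U) \<le> \<rho> ^ m + (1 / \<mu> ^ m) * F U" by simp
    qed (use k in simp)
    also have "\<dots> = \<rho> ^ m + (1 / \<mu> ^ m) * row_expect n w k F"
      using k by (simp only: row_expect_add row_expect_cmult) (simp add: row_expect_const)
    also have "\<dots> \<le> \<rho> ^ m + (1 / \<mu> ^ m) * (real CARD('a) ^ b * (c * T))"
      using that(2) \<mu> by (intro add_left_mono mult_left_mono) auto
    finally show ?thesis by simp
  qed
  have sq: "sqrt \<beta> ^ (2 * l) = \<beta> ^ l" for l using beta_bounds by (simp add: power_mult)
  have sb: "0 \<le> sqrt \<beta>" "sqrt \<beta> \<le> 1" using beta_bounds by auto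
  have fin: "\<rho> ^ m + real CARD('a) ^ b * (c * T) / \<mu> ^ m \<le>
      \<rho> ^ m + real CARD('a) ^ b * ((1 + (real CARD('a) - 1) * \<mu>) * sqrt \<beta>) ^ n / \<mu> ^ m"
    if "c \<le> sqrt \<beta> ^ n" for c
  proof -
    have "c * T \<le> sqrt \<beta> ^ n * T" using that T0 by (intro mult_right_mono)
    also have "\<dots> = ((1 + (real CARD('a) - 1) * \<mu>) * sqrt \<beta>) ^ n"
      unfolding T_def power_mult_distrib by simp
    finally show ?thesis using \<mu> by (intro add_left_mono divide_right_mono mult_left_mono) auto
  qed
  \<comment> \<open>late rows: few vectors have survived; early rows: \<open>X U\<close> is still large\<close>
  show ?thesis
  proof (cases "n \<le> 2 * k")
    case True
    have "row_expect n w k (\<lambda>U. char_error n \<rho> (X U)) \<le> \<rho> ^ m + real CARD('a) ^ b * (\<beta> ^ k * T) / \<mu> ^ m"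
    proof (rule E)
      fix U assume U: "reach k U"
      have "0\<^sub>v n \<in> X U" "finite (X U)" using X[OF U] finite_is_subspace by (auto simp: is_subspace_def)
      then have "1 \<le> real (card (X U))" by (metis One_nat_def Suc_leI card_gt_0_iff empty_iff of_nat_1 of_nat_mono)
      then show "Z U / real (card (X U)) \<le> Z U" using Z0[of U] by (simp add: divide_le_eq mult_le_cancel_left1)
    next
      have "1 * (\<beta> ^ k * T) \<le> real CARD('a) ^ b * (\<beta> ^ k * T)"
        using T0 beta_bounds ca by (intro mult_right_mono) auto
      then show "row_expect n w k Z \<le> real CARD('a) ^ b * (\<beta> ^ k * T)" using EZ by linarith
    qed
    also have "\<beta> ^ k \<le> sqrt \<beta> ^ n" unfolding sq[symmetric] using True sb by (intro power_decreasing)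
    from fin[OF this] have "\<rho> ^ m + real CARD('a) ^ b * (\<beta> ^ k * T) / \<mu> ^ m \<le>
      \<rho> ^ m + real CARD('a) ^ b * ((1 + (real CARD('a) - 1) * \<mu>) * sqrt \<beta>) ^ n / \<mu> ^ m" .
    finally show ?thesis .
  next
    case False
    have "row_expect n w k (\<lambda>U. char_error n \<rho> (X U)) \<le> \<rho> ^ m + real CARD('a) ^ b * (q ^ (n - k) * T) / \<mu> ^ m"
    proof (rule E)
      fix U assume U: "reach k U"
      have "0\<^sub>v n \<in> X U" "finite (X U)" using X[OF U] finite_is_subspace by (auto simp: is_subspace_def)
      then have cpos: "0 < real (card (X U))" by (auto simp: card_gt_0_iff)
      have "real CARD('a) ^ n \<le> real CARD('a) ^ (b + k) * real (card (X U))"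
        using X[OF U] by (metis of_nat_mono of_nat_mult of_nat_power)
      then have "real CARD('a) ^ (n - k) * real CARD('a) ^ k \<le> real CARD('a) ^ b * real (card (X U)) * real CARD('a) ^ k"
        using k by (simp add: power_add mult_ac flip: power_add)
      then have "real CARD('a) ^ (n - k) \<le> real CARD('a) ^ b * real (card (X U))"
        using ca by simp
      then have "1 / real (card (X U)) \<le> real CARD('a) ^ b * q ^ (n - k)"
        using ca cpos by (simp add: q power_one_over field_simps)
      then have "Z U * (1 / real (card (X U))) \<le> T * (real CARD('a) ^ b * q ^ (n - k))"
        using ZT[of U] Z0[of U] T0 by (intro mult_mono) auto
      then show "Z U / real (card (X U)) \<le> real CARD('a) ^ b * (q ^ (n - k) * T)" by (simp add: mult_ac)
    next
      show "row_expect n w k (\<lambda>U. real CARD('a) ^ b * (q ^ (n - k) * T)) \<le> real CARD('a) ^ b * (q ^ (n - k) * T)"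
        using k by (simp add: row_expect_const)
    qed
    also have "q ^ (n - k) \<le> sqrt \<beta> ^ n"
    proof -
      have "q ^ (n - k) \<le> \<beta> ^ (n - k)" using q_bounds beta_bounds by (intro power_mono) auto
      also have "\<dots> \<le> sqrt \<beta> ^ n" unfolding sq[symmetric] using False sb by (intro power_decreasing) auto
      finally show ?thesis .
    qed
    from fin[OF this] have "\<rho> ^ m + real CARD('a) ^ b * (q ^ (n - k) * T) / \<mu> ^ m \<le>
      \<rho> ^ m + real CARD('a) ^ b * ((1 + (real CARD('a) - 1) * \<mu>) * sqrt \<beta>) ^ n / \<mu> ^ m" .
    finally show ?thesis .
  qed
qed

text \<open>The factor 2 * n counts two errors, for U and for \<open>U \<inter> H\<close>, in each
  of n rows.\<close>

lemma row_expect_approx: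
  assumes \<mu>: "0 < \<mu>" "\<mu> \<le> 1"
  shows "\<bar>row_expect n w n (state_value (\<lambda>s e. of_bool (s = i \<and> e = j))) - dim_chain q i j n b (n - b)\<bar>
    \<le> 2 * real n * (\<rho> ^ m + real CARD('a) ^ b * ((1 + (real CARD('a) - 1) * \<mu>) * sqrt \<beta>) ^ n / \<mu> ^ m)"
    (is "_ \<le> 2 * real n * ?\<delta>")
proof -
  have ch: "dim_chain q i j 0 = (\<lambda>s e. of_bool (s = i \<and> e = j))" by (intro ext) simp
  have "\<bar>row_expect n w n (state_value (\<lambda>s e. of_bool (s = i \<and> e = j))) - dim_chain q i j n b (n - b)\<bar> \<le>
      (\<Sum>l<n. row_expect n w l (\<lambda>U. char_error n \<rho> U + char_error n \<rho> (U \<inter> H)))"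
    using row_expect_telescope[of n i j] by (simp add: ch)
  also have "\<dots> \<le> (\<Sum>l<n. ?\<delta> + ?\<delta>)"
  proof (rule sum_mono)
    fix l assume l: "l \<in> {..<n}"
    have "row_expect n w l (\<lambda>U. char_error n \<rho> U) \<le> ?\<delta>"
    proof (rule row_expect_char_error_le[OF _ \<mu>])
      fix U assume "reach l U"
      then obtain s e where "is_subspace n U" "card U = CARD('a) ^ (s + e)" "n \<le> s + e + l"
        by (auto simp: reach_def)
      moreover then have "CARD('a) ^ n \<le> CARD('a) ^ (b + l + (s + e))"
        using card_field_gt_1[where 'a = 'a] by (intro power_increasing) auto
      ultimately show "is_subspace n U \<and> U \<subseteq> U \<and> CARD('a) ^ n \<le> CARD('a) ^ (b + l) * card U"
        by (simp add: power_add)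
    qed (use l in auto)
    moreover have "row_expect n w l (\<lambda>U. char_error n \<rho> (U \<inter> H)) \<le> ?\<delta>"
    proof (rule row_expect_char_error_le[OF _ \<mu>])
      fix U assume "reach l U"
      then obtain s e where "is_subspace n U" "card (U \<inter> H) = CARD('a) ^ e" "n \<le> e + b + l"
        by (auto simp: reach_def)
      moreover then have "CARD('a) ^ n \<le> CARD('a) ^ (b + l + e)"
        using card_field_gt_1[where 'a = 'a] by (intro power_increasing) auto
      ultimately show "is_subspace n (U \<inter> H) \<and> U \<inter> H \<subseteq> U \<and> CARD('a) ^ n \<le> CARD('a) ^ (b + l) * card (U \<inter> H)"
        using is_subspace_Int[OF _ H] by (simp add: power_add)
    qed (use l in auto)
    ultimately show "row_expect n w l (\<lambda>U. char_error n \<rho> U + char_error n \<rho> (U \<inter> H)) \<le> ?\<delta> + ?\<delta>"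
      by (simp add: row_expect_add)
  qed
  also have "\<dots> = 2 * real n * ?\<delta>" by simp
  finally show ?thesis .
qed

end

section \<open>The uniform model in closed form\<close>

lemma qpoch_0 [simp]: "qpoch p 0 = 1"
  by (simp add: qpoch_def)

lemma qpoch_Suc: "qpoch p (Suc m) = qpoch p m * (1 - (1 / real p) ^ Suc m)"
  by (simp add: qpoch_def power_one_over)

lemma qpoch_pos: "2 \<le> p \<Longrightarrow> 0 < qpoch p m"
  by (auto simp: qpoch_def intro!: prod_pos)

text \<open>Serves to show that the infinite product is positive. The constant 1/4 alone is not
  inductive; the extra term h absorbs the next factor because (1/4 + h) * (1 - h) is at least 1/4 +
  h/2 for h up to 1/4. For p = 2 and m = 1 there is equality.\<close>

lemma qpoch_lower:
  assumes "2 \<le> p" "1 \<le> m"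
  shows "1 / 4 + (1 / 2) ^ Suc m \<le> qpoch p m"
  using assms(2)
proof (induction m rule: dec_induct)
  case base
  have "1 / real p \<le> 1 / 2" using assms(1) by (simp add: field_simps)
  then show ?case by (simp add: qpoch_def)
next
  case (step m)
  define h :: real where "h = (1 / 2) ^ Suc m"
  have h: "0 < h" "h \<le> 1 / 4"
  proof -
    have "h \<le> (1 / 2) ^ 2" unfolding h_def using step by (intro power_decreasing) auto
    then show "h \<le> 1 / 4" by (simp add: power2_eq_square)
  qed (simp add: h_def)
  have "(1 / real p) ^ Suc m \<le> h"
    unfolding h_def using assms(1) by (intro power_mono) (auto simp: field_simps)
  then have "(1 / 4 + h) * (1 - h) \<le> qpoch p m * (1 - (1 / real p) ^ Suc m)"
    using step h qpoch_pos[OF assms(1), THEN less_imp_le] by (intro mult_mono) (auto simp: h_def)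
  moreover have "1 / 4 + h / 2 \<le> (1 / 4 + h) * (1 - h)"
  proof -
    have "h * h \<le> h * (1 / 4)" using h by (intro mult_left_mono) auto
    moreover have "(1 / 4 + h) * (1 - h) = 1 / 4 + 3 / 4 * h - h * h" by (simp add: algebra_simps diff_divide_distrib)
    ultimately show ?thesis using h by linarith
  qed
  ultimately have "1 / 4 + h / 2 \<le> qpoch p (Suc m)" unfolding qpoch_Suc by linarith
  then show ?case by (simp add: h_def)
qed

lemma qpoch_tendsto:
  assumes "2 \<le> p"
  obtains L where "0 < L" "qpoch p \<longlonglongrightarrow> L"
proof -
  have lb: "1 / 4 \<le> qpoch p m" for m
  proof (cases "m = 0")
    case False
    have "0 \<le> (1 / 2 :: real) ^ Suc m" by simp
    then show ?thesis using qpoch_lower[OF assms, of m] False by linarith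
  qed simp
  have "decseq (qpoch p)"
    using qpoch_pos[OF assms] by (intro decseq_SucI) (simp add: qpoch_Suc mult_left_le less_imp_le)
  then obtain L where L: "qpoch p \<longlonglongrightarrow> L"
    using decseq_convergent[of "qpoch p" "1 / 4"] lb by blast
  have "1 / 4 \<le> L" using LIMSEQ_le_const[OF L, of "1 / 4"] lb by blast
  then show ?thesis using that[of L] L by simp
qed

section \<open>The dimension chain and its limit\<close>

text \<open>Neither component can grow, and each row lowers their sum by at most one.\<close>

lemma dim_chain_eq_0:
  assumes "s < i \<or> e < j \<or> t + i + j < s + e"
  shows "dim_chain q i j t s e = 0"
  using assms
proof (induction t arbitrary: s e)
  case (Suc t)
  have 1: "dim_chain q i j t s e = 0" using Suc by auto
  have 2: "(q ^ e - q ^ (s + e)) * dim_chain q i j t (s - 1) e = 0"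
    using Suc by (cases s) auto
  have 3: "(1 - q ^ e) * dim_chain q i j t s (e - 1) = 0"
    using Suc by (cases e) auto
  show ?case unfolding dim_chain.simps 1 2 3 by simp
qed auto

text \<open>Starting from \<open>(i + u, j + v)\<close> with target \<open>(i, j)\<close>, the first component has to drop \<open>u\<close> times and the
  second \<open>v\<close> times; \<open>r\<close> rows cause no drop. \<open>Q\<close> will be \<open>qpoch p\<close>.\<close>

definition dim_chain_closed :: "real \<Rightarrow> (nat \<Rightarrow> real) \<Rightarrow> nat \<Rightarrow> nat \<Rightarrow> nat \<Rightarrow> nat \<Rightarrow> nat \<Rightarrow> real" where
  "dim_chain_closed q Q i j r u v = q ^ ((i + j) * r + j * u)
     * (Q (j + v) / (Q j * Q v)) * (Q (i + u) / (Q i * Q u)) * (Q (r + u + v) / Q r)"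

text \<open>After multiplication by \<open>1 - q ^ Suc t\<close>, the three transitions contribute
  the closed form K times \<open>q ^ (u + v) * (1 - q ^ r)\<close>,
  \<open>q ^ v * (1 - q ^ u)\<close> and \<open>1 - q ^ v\<close>. These telescope to
  \<open>1 - q ^ (r + u + v)\<close>, as in the recursion of q-multinomial coefficients.\<close>

lemma dim_chain_closed_form:
  assumes Q0: "Q 0 = 1" and QS: "\<And>m. Q (Suc m) = Q m * (1 - q ^ Suc m)"
    and q1: "\<And>m. q ^ Suc m \<noteq> 1" and t: "t = r + u + v"
  shows "dim_chain q i j t (i + u) (j + v) = dim_chain_closed q Q i j r u v"
proof -
  have Q: "Q m \<noteq> 0" for m
  proof (induction m)
    case (Suc m)
    then show ?case using q1[of m] by (simp only: QS) simp
  qed (simp add: Q0)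
  show ?thesis using t
  proof (induction t arbitrary: r u v)
    case 0
    then show ?case using Q by (simp add: dim_chain_closed_def Q0)
  next
    case (Suc t)
    let ?K = "dim_chain_closed q Q i j"
    have qn: "1 - q ^ Suc t \<noteq> 0" using q1[of t] by linarith
    have 1: "q ^ (i + u + (j + v)) * dim_chain q i j t (i + u) (j + v) * (1 - q ^ Suc t) =
        ?K r u v * (q ^ (u + v) * (1 - q ^ r))"
    proof (cases r)
      \<comment> \<open>With r = 0 only u + v - 1 rows would remain for u + v drops.\<close>
      case 0
      then show ?thesis using Suc.prems by (simp add: dim_chain_eq_0)
    next
      case (Suc r')
      then have t: "t = r' + u + v" using Suc.prems by simp
      have K: "?K r u v * (1 - q ^ Suc r') = q ^ (i + j) * ?K r' u v * (1 - q ^ Suc t)"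
        using Q q1[of r'] unfolding dim_chain_closed_def Suc t by (simp add: QS power_add field_simps)
      have "q ^ (i + u + (j + v)) * ?K r' u v * (1 - q ^ Suc t) =
          q ^ (u + v) * (q ^ (i + j) * ?K r' u v * (1 - q ^ Suc t))"
        by (simp only: power_add mult_ac)
      then show ?thesis using Suc.IH[OF t] K unfolding Suc by (simp only: mult_ac)
    qed
    have 2: "(q ^ (j + v) - q ^ (i + u + (j + v))) * dim_chain q i j t (i + u - 1) (j + v) * (1 - q ^ Suc t) =
        ?K r u v * (q ^ v * (1 - q ^ u))"
    proof (cases u)
      \<comment> \<open>With u = 0 the first component is already at its target i: for i > 0 a
        further drop would pass below it, for i = 0 the coefficient vanishes. The case v = 0 below
        is analogous.\<close>
      case 0
      then show ?thesis by (cases i) (simp_all add: dim_chain_eq_0)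
    next
      case (Suc u')
      then have t: "t = r + u' + v" using Suc.prems by simp
      have "?K r u v * (1 - q ^ Suc u') = q ^ j * ?K r u' v * ((1 - q ^ Suc t) * (1 - q ^ Suc (i + u')))"
        using Q q1[of u'] unfolding dim_chain_closed_def Suc t by (simp add: QS power_add field_simps)
      moreover have "q ^ (j + v) - q ^ (i + Suc u' + (j + v)) = q ^ v * (q ^ j * (1 - q ^ Suc (i + u')))"
        by (simp add: power_add algebra_simps)
      ultimately show ?thesis using Suc.IH[OF t] unfolding Suc add_Suc_right diff_Suc_1
        by (simp only: mult_ac)
    qed
    have 3: "(1 - q ^ (j + v)) * dim_chain q i j t (i + u) (j + v - 1) * (1 - q ^ Suc t) =
        ?K r u v * (1 - q ^ v)"
    proof (cases v)
      case 0
      then show ?thesis by (cases j) (simp_all add: dim_chain_eq_0)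
    next
      case (Suc v')
      then have t: "t = r + u + v'" using Suc.prems by simp
      have "?K r u v * (1 - q ^ Suc v') = ?K r u v' * ((1 - q ^ Suc t) * (1 - q ^ Suc (j + v')))"
        using Q q1[of v'] unfolding dim_chain_closed_def Suc t by (simp add: QS power_add field_simps)
      then show ?thesis using Suc.IH[OF t] unfolding Suc add_Suc_right diff_Suc_1
        by (simp only: mult_ac)
    qed
    have "dim_chain q i j (Suc t) (i + u) (j + v) * (1 - q ^ Suc t) =
       ?K r u v * (q ^ (u + v) * (1 - q ^ r)) + ?K r u v * (q ^ v * (1 - q ^ u)) + ?K r u v * (1 - q ^ v)"
      unfolding dim_chain.simps(2) 1[symmetric] 2[symmetric] 3[symmetric] by (simp only: distrib_right)
    also have "\<dots> = ?K r u v * (1 - q ^ Suc t)"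
      unfolding Suc.prems by (simp add: power_add algebra_simps)
    finally show ?case using qn by simp
  qed
qed

text \<open>From (b, n - b) to (i, j) in n rows there are u = b - i and v = n - b - j drops, hence
  always r = i + j rows without a drop. Only v grows; the shift n = m + (b + j) makes v = m. The
  ratio of Pochhammer values at j + m and m tends to 1, and the value at n tends to L.\<close>

lemma dim_chain_tendsto:
  assumes p: "2 \<le> p" and L: "qpoch p \<longlonglongrightarrow> L" "0 < L" and i: "i \<le> b"
  shows "(\<lambda>n. dim_chain (1 / real p) i j n b (n - b)) \<longlonglongrightarrow>
    (1 / real p) ^ ((i + j)\<^sup>2 + j * (b - i)) * L * qpoch p b /
      (qpoch p i * qpoch p j * qpoch p (b - i) * qpoch p (i + j))"
proof -
  let ?q = "1 / real p"
  let ?Q = "qpoch p"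
  have Q: "?Q m \<noteq> 0" for m using qpoch_pos[OF p, of m] by simp
  have q1: "?q ^ Suc m \<noteq> 1" for m
    using power_Suc_less_one[of ?q m] p by simp
  have ev: "dim_chain ?q i j (m + (b + j)) b (m + (b + j) - b) =
      ?q ^ ((i + j)\<^sup>2 + j * (b - i)) * (?Q (m + j) / (?Q j * ?Q m)) * (?Q b / (?Q i * ?Q (b - i)))
        * (?Q (m + (b + j)) / ?Q (i + j))" for m
  proof -
    have "m + (b + j) = (i + j) + (b - i) + m" using i by simp
    from dim_chain_closed_form[of ?Q ?q, OF qpoch_0 qpoch_Suc _ this, of i j] q1 show ?thesis
      using i by (simp add: dim_chain_closed_def power2_eq_square ac_simps)
  qed
  have "(\<lambda>m. ?q ^ ((i + j)\<^sup>2 + j * (b - i)) * (?Q (m + j) / (?Q j * ?Q m)) * (?Q b / (?Q i * ?Q (b - i)))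
        * (?Q (m + (b + j)) / ?Q (i + j))) \<longlonglongrightarrow>
      ?q ^ ((i + j)\<^sup>2 + j * (b - i)) * (L / (?Q j * L)) * (?Q b / (?Q i * ?Q (b - i))) * (L / ?Q (i + j))"
    using L Q LIMSEQ_ignore_initial_segment[OF L(1)] by (intro tendsto_intros) auto
  then have "(\<lambda>m. dim_chain ?q i j (m + (b + j)) b (m + (b + j) - b)) \<longlonglongrightarrow>
      ?q ^ ((i + j)\<^sup>2 + j * (b - i)) * (L / (?Q j * L)) * (?Q b / (?Q i * ?Q (b - i))) * (L / ?Q (i + j))"
    by (simp only: ev)
  then have "(\<lambda>n. dim_chain ?q i j n b (n - b)) \<longlonglongrightarrow>
      ?q ^ ((i + j)\<^sup>2 + j * (b - i)) * (L / (?Q j * L)) * (?Q b / (?Q i * ?Q (b - i))) * (L / ?Q (i + j))"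
    by (rule LIMSEQ_offset)
  also have "?q ^ ((i + j)\<^sup>2 + j * (b - i)) * (L / (?Q j * L)) * (?Q b / (?Q i * ?Q (b - i))) * (L / ?Q (i + j)) =
      ?q ^ ((i + j)\<^sup>2 + j * (b - i)) * L * ?Q b / (?Q i * ?Q j * ?Q (b - i) * ?Q (i + j))"
    using L Q by (simp add: field_simps)
  finally show ?thesis .
qed

section \<open>The law of the kernel\<close>

text \<open>In the application \<tau> is \<open>sqrt \<beta>\<close>. The choice of \<mu> keeps p *
  \<tau> * \<mu> at most (1 - \<tau>) / 2, so the base \<sigma> is at most (1 + \<tau>) / 2. With m
  proportional to n everything decays exponentially, which also absorbs the factor n.\<close>

lemma error_rate:
  assumes \<rho>: "0 < \<rho>" "\<rho> < 1" and \<tau>: "0 < \<tau>" "\<tau> < (1::real)" and p: "1 \<le> (p::real)" and C: "0 \<le> C"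
  obtains \<mu> m where "0 < \<mu>" "\<mu> \<le> 1"
    "(\<lambda>n. 2 * real n * (\<rho> ^ m n + C * ((1 + (p - 1) * \<mu>) * \<tau>) ^ n / \<mu> ^ m n)) \<longlonglongrightarrow> 0"
proof -
  define \<mu> where "\<mu> = min 1 ((1 - \<tau>) / (2 * p * \<tau>))"
  have \<mu>: "0 < \<mu>" "\<mu> \<le> 1" using \<tau> p by (auto simp: \<mu>_def)
  define \<sigma> where "\<sigma> = (1 + (p - 1) * \<mu>) * \<tau>"
  have \<sigma>0: "0 < \<sigma>" unfolding \<sigma>_def using \<tau> \<mu> p by (intro mult_pos_pos add_pos_nonneg) auto
  have \<sigma>1: "\<sigma> < 1"
  proof -
    have "p * \<tau> * \<mu> \<le> p * \<tau> * ((1 - \<tau>) / (2 * p * \<tau>))"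
      unfolding \<mu>_def using \<tau> p by (intro mult_left_mono) auto
    also have "\<dots> = (1 - \<tau>) / 2" using \<tau> p by (simp add: field_simps)
    finally have "p * \<tau> * \<mu> \<le> (1 - \<tau>) / 2" .
    moreover have "0 \<le> \<mu> * \<tau>" using \<mu> \<tau> by simp
    moreover have "\<sigma> = \<tau> + p * \<tau> * \<mu> - \<mu> * \<tau>" by (simp add: \<sigma>_def algebra_simps)
    moreover have "\<sigma> < 1" if "A \<le> (1 - \<tau>) / 2" "0 \<le> B" "\<sigma> = \<tau> + A - B" for A B :: real
      using that \<tau> by simp
    ultimately show ?thesis by blast
  qed
  \<comment> \<open>K fixes the threshold m n = n div K: then
    \<open>\<sigma> ^ n / \<mu> ^ m n\<close> is at most \<open>(1 / 2) ^ m n\<close>, so dividing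
    by the power of \<mu> does no harm.\<close>
  obtain K where K: "\<sigma> ^ K < \<mu> / 2" using real_arch_pow_inv[of "\<mu> / 2" \<sigma>] \<mu> \<sigma>1 by auto
  have K0: "0 < K" using K \<mu> by (cases K) auto
  define m where "m n = n div K" for n
  define \<kappa> where "\<kappa> = max \<rho> (1 / 2)"
  have \<kappa>: "0 < \<kappa>" "\<kappa> < 1" using \<rho> by (auto simp: \<kappa>_def)
  have bound: "2 * real n * (\<rho> ^ m n + C * \<sigma> ^ n / \<mu> ^ m n) \<le>
      2 * K * (1 + C) * (real (m n) * \<kappa> ^ m n + \<kappa> ^ m n)" for n
  proof -
    have "n = K * m n + n mod K" by (simp add: m_def)
    moreover have "n mod K \<le> K" using K0 by (simp add: less_imp_le)
    ultimately have "n \<le> K * (m n + 1)" by (simp add: distrib_left)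
    then have n: "real n \<le> real K * (real (m n) + 1)" by (metis of_nat_1 of_nat_add of_nat_mono of_nat_mult)
    have "\<sigma> ^ n \<le> \<sigma> ^ (K * m n)"
      using \<sigma>0 \<sigma>1 \<open>n = K * m n + n mod K\<close> by (intro power_decreasing) auto
    also have "\<dots> \<le> (\<mu> / 2) ^ m n"
      unfolding power_mult using K \<sigma>0 by (intro power_mono) auto
    finally have "\<sigma> ^ n / \<mu> ^ m n \<le> (1 / 2) ^ m n"
      using \<mu> by (simp add: power_divide field_simps)
    also have "\<dots> \<le> \<kappa> ^ m n" by (intro power_mono) (auto simp: \<kappa>_def)
    finally have "C * (\<sigma> ^ n / \<mu> ^ m n) \<le> C * \<kappa> ^ m n" using C by (rule mult_left_mono)
    moreover have "\<rho> ^ m n \<le> \<kappa> ^ m n" using \<rho> by (intro power_mono) (auto simp: \<kappa>_def)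
    ultimately have le: "\<rho> ^ m n + C * \<sigma> ^ n / \<mu> ^ m n \<le> (1 + C) * \<kappa> ^ m n"
      by (simp add: algebra_simps)
    have "2 * real n * (\<rho> ^ m n + C * \<sigma> ^ n / \<mu> ^ m n) \<le> 2 * real n * ((1 + C) * \<kappa> ^ m n)"
      using le by (intro mult_left_mono) auto
    also have "\<dots> \<le> 2 * (real K * (real (m n) + 1)) * ((1 + C) * \<kappa> ^ m n)"
      using n C \<kappa> by (intro mult_right_mono mult_left_mono) auto
    finally show ?thesis by (simp add: algebra_simps)
  qed
  have "filterlim (\<lambda>n. m n) at_top at_top"
    unfolding filterlim_at_top
  proof (intro allI)
    fix Z
    have "Z \<le> m n" if "Z * K \<le> n" for n
      unfolding m_def using K0 that by (simp add: less_eq_div_iff_mult_less_eq)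
    then show "\<forall>\<^sub>F n in sequentially. Z \<le> m n" by (rule eventually_sequentiallyI)
  qed
  moreover have "(\<lambda>l. 2 * K * (1 + C) * (real l * \<kappa> ^ l + \<kappa> ^ l)) \<longlonglongrightarrow> 2 * K * (1 + C) * (0 + 0)"
    using \<kappa> by (intro tendsto_intros powser_times_n_limit_0) auto
  ultimately have lim: "(\<lambda>n. 2 * K * (1 + C) * (real (m n) * \<kappa> ^ m n + \<kappa> ^ m n)) \<longlonglongrightarrow> 0"
    using filterlim_compose[of "\<lambda>l. 2 * K * (1 + C) * (real l * \<kappa> ^ l + \<kappa> ^ l)" "nhds 0" sequentially m sequentially] by simp
  have "(\<lambda>n. 2 * real n * (\<rho> ^ m n + C * \<sigma> ^ n / \<mu> ^ m n)) \<longlonglongrightarrow> 0"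
  proof (rule real_tendsto_sandwich[OF _ _ tendsto_const lim])
    show "\<forall>\<^sub>F n in sequentially. 0 \<le> 2 * real n * (\<rho> ^ m n + C * \<sigma> ^ n / \<mu> ^ m n)"
      using \<rho> C \<sigma>0 \<mu> by (intro always_eventually) auto
    show "\<forall>\<^sub>F n in sequentially. 2 * real n * (\<rho> ^ m n + C * \<sigma> ^ n / \<mu> ^ m n) \<le>
      2 * K * (1 + C) * (real (m n) * \<kappa> ^ m n + \<kappa> ^ m n)"
      using bound by (intro always_eventually) auto
  qed
  then show ?thesis using that[of \<mu> m] \<mu> by (simp add: \<sigma>_def)
qed

section \<open>From laws of matrices to row expectations\<close>

lemma row_expect_eq_sum:
  "row_expect n w k F = (\<Sum>g\<in>PiE {..<k} (\<lambda>_. carrier_vec n).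
     (\<Prod>i<k. row_prob n (w i) (g i)) * F {x \<in> carrier_vec n. \<forall>i<k. g i \<bullet> x = 0})"
proof (induction k arbitrary: F)
  case 0
  then show ?case by simp
next
  case (Suc k)
  let ?V = "\<lambda>_. carrier_vec n :: 'a vec set"
  have ins: "PiE {..<Suc k} ?V = (\<lambda>(r, g). g(k := r)) ` (carrier_vec n \<times> PiE {..<k} ?V)"
    by (simp add: lessThan_Suc PiE_insert_eq)
  have orthk: "{x \<in> carrier_vec n. \<forall>i<Suc k. (g(k := r)) i \<bullet> x = 0} =
      orth_part r {x \<in> carrier_vec n. \<forall>i<k. g i \<bullet> x = 0}" for g and r :: "'a vec"
    by (auto simp: orth_part_def less_Suc_eq)
  have "(\<Sum>g\<in>PiE {..<Suc k} ?V. (\<Prod>i<Suc k. row_prob n (w i) (g i)) * F {x \<in> carrier_vec n. \<forall>i<Suc k. g i \<bullet> x = 0}) =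
     (\<Sum>(r, g)\<in>carrier_vec n \<times> PiE {..<k} ?V. (\<Prod>i<Suc k. row_prob n (w i) ((g(k := r)) i)) *
        F {x \<in> carrier_vec n. \<forall>i<Suc k. (g(k := r)) i \<bullet> x = 0})"
    unfolding ins using inj_combinator[of k "{..<k}" ?V]
    by (subst sum.reindex) (auto simp: case_prod_unfold)
  also have "\<dots> = (\<Sum>(r, g)\<in>carrier_vec n \<times> PiE {..<k} ?V. (\<Prod>i<k. row_prob n (w i) (g i)) *
        (row_prob n (w k) r * F (orth_part r {x \<in> carrier_vec n. \<forall>i<k. g i \<bullet> x = 0})))"
    unfolding orthk by (intro sum.cong refl) (auto simp: mult.assoc)
  also have "\<dots> = (\<Sum>g\<in>PiE {..<k} ?V. \<Sum>r\<in>carrier_vec n. (\<Prod>i<k. row_prob n (w i) (g i)) *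
        (row_prob n (w k) r * F (orth_part r {x \<in> carrier_vec n. \<forall>i<k. g i \<bullet> x = 0})))"
    by (subst sum.swap) (simp add: sum.cartesian_product)
  also have "\<dots> = row_expect n w (Suc k) F"
    by (simp add: Suc sum_distrib_left)
  finally show ?case by simp
qed

text \<open>The congruence assumption reconciles \<open>row A\<close>, which may take any values
  from index n on, with the extensional functions in \<open>PiE\<close>, which are undefined
  there.\<close>

lemma sum_carrier_mat:
  fixes f :: "(nat \<Rightarrow> 'a::{finite,field} vec) \<Rightarrow> real"
  assumes "\<And>g h. (\<And>i. i < n \<Longrightarrow> g i = h i) \<Longrightarrow> f g = f h"
  shows "(\<Sum>A\<in>carrier_mat n m. f (row A)) = (\<Sum>g\<in>PiE {..<n} (\<lambda>_. carrier_vec m). f g)"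
proof (rule sum.reindex_bij_witness[of _ "\<lambda>g. mat n m (\<lambda>(i, j). g i $ j)" "\<lambda>A. restrict (row A) {..<n}"])
  fix g assume g: "g \<in> PiE {..<n} (\<lambda>_. carrier_vec m :: 'a vec set)"
  show "restrict (row (mat n m (\<lambda>(i, j). g i $ j))) {..<n} = g"
  proof
    fix i show "restrict (row (mat n m (\<lambda>(i, j). g i $ j))) {..<n} i = g i"
    proof (cases "i < n")
      case True
      then have "g i \<in> carrier_vec m" using g by auto
      then show ?thesis using True by (auto simp: vec_eq_iff)
    qed (use g in \<open>auto simp: PiE_def extensional_def\<close>)
  qed
qed (auto intro!: assms eq_matI)

lemma finite_carrier_mat: "finite (carrier_mat n m :: 'a::{finite,field} mat set)"
proof -
  have "carrier_mat n m \<subseteq> (\<lambda>g. mat n m (\<lambda>(i, j). g i $ j)) ` PiE {..<n} (\<lambda>_. carrier_vec m :: 'a vec set)"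
  proof
    fix A :: "'a mat" assume A: "A \<in> carrier_mat n m"
    then have "A = mat n m (\<lambda>(i, j). restrict (row A) {..<n} i $ j)" by (intro eq_matI) auto
    moreover have "restrict (row A) {..<n} \<in> PiE {..<n} (\<lambda>_. carrier_vec m)" using A by auto
    ultimately show "A \<in> (\<lambda>g. mat n m (\<lambda>(i, j). g i $ j)) ` PiE {..<n} (\<lambda>_. carrier_vec m)"
      by (rule image_eqI[where x = "restrict (row A) {..<n}"])
  qed
  then show ?thesis by (rule finite_subset) (intro finite_imageI finite_PiE, auto)
qed

lemma mat_ker_eq: "A \<in> carrier_mat n n \<Longrightarrow> mat_ker n A = {x \<in> carrier_vec n. \<forall>i<n. row A i \<bullet> x = 0}"
  by (auto simp: mat_ker_def vec_eq_iff)

lemma (in prob_space) prob_eq_sum_countspace: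
  assumes X: "X \<in> measurable M (count_space A)" and A: "finite A"
  shows "\<P>(\<omega> in M. P (X \<omega>)) = (\<Sum>a\<in>A. \<P>(\<omega> in M. X \<omega> = a) * of_bool (P a))"
proof -
  have XA: "X \<omega> \<in> A" if "\<omega> \<in> space M" for \<omega> using measurable_space[OF X that] by simp
  have ev: "{\<omega> \<in> space M. X \<omega> = a} \<in> sets M" if "a \<in> A" for a
    using measurable_sets[OF X, of "{a}"] that by (simp add: vimage_def Int_def conj_commute)
  have "{\<omega> \<in> space M. P (X \<omega>)} = (\<Union>a\<in>{a \<in> A. P a}. {\<omega> \<in> space M. X \<omega> = a})"
    using XA by auto
  then have "\<P>(\<omega> in M. P (X \<omega>)) = (\<Sum>a\<in>{a \<in> A. P a}. \<P>(\<omega> in M. X \<omega> = a))"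
    using A ev by (simp, intro finite_measure_finite_Union) (auto simp: disjoint_family_on_def)
  also have "\<dots> = (\<Sum>a\<in>A. \<P>(\<omega> in M. X \<omega> = a) * of_bool (P a))"
    using A by (simp add: Int_def)
  finally show ?thesis .
qed

definition entry_law :: "'w measure \<Rightarrow> ('w \<Rightarrow> 'a mat) \<Rightarrow> nat \<Rightarrow> nat \<Rightarrow> 'a \<Rightarrow> real" where
  "entry_law \<Omega> M i j x = \<P>(\<omega> in \<Omega>. M \<omega> $$ (i, j) = x)"

lemma balanced_row_entry_law:
  fixes M :: "'w \<Rightarrow> 'a::{finite,field} mat"
  assumes "prob_space \<Omega>" and M: "balanced_random_matrix \<alpha> n \<Omega> M" and k: "k < n"
  shows "balanced_row \<alpha> n (entry_law \<Omega> M k)"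
  unfolding balanced_row_def
proof (intro allI impI conjI)
  interpret prob_space \<Omega> by fact
  fix j x assume j: "j < n"
  show "0 \<le> entry_law \<Omega> M k j x" by (simp add: entry_law_def)
  show "entry_law \<Omega> M k j x \<le> 1 - \<alpha>"
    using M k j by (simp add: balanced_random_matrix_def entry_law_def)
  have iv: "indep_vars (\<lambda>_. count_space UNIV) (\<lambda>(i, j) \<omega>. M \<omega> $$ (i, j)) ({..<n} \<times> {..<n})"
    using M by (simp add: balanced_random_matrix_def)
  then have "(\<lambda>\<omega>. M \<omega> $$ (k, j)) \<in> measurable \<Omega> (count_space UNIV)"
    using k j unfolding indep_vars_def by force
  from prob_eq_sum_countspace[OF this, of "\<lambda>_. True"]
  show "(\<Sum>x\<in>UNIV. entry_law \<Omega> M k j x) = 1"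
    by (simp add: entry_law_def prob_space)
qed

text \<open>\<open>0 < n\<close> makes the set of entries nonempty, as the product formula for
  independent variables requires; it also keeps the intersection of the entry events inside the
  space.\<close>

lemma prob_eq_matrix:
  fixes M :: "'w \<Rightarrow> 'a::{finite,field} mat"
  assumes "prob_space \<Omega>" and M: "balanced_random_matrix \<alpha> n \<Omega> M" and n: "0 < n"
    and A: "A \<in> carrier_mat n n"
  shows "\<P>(\<omega> in \<Omega>. M \<omega> = A) = (\<Prod>i<n. row_prob n (entry_law \<Omega> M i) (row A i))"
proof -
  interpret prob_space \<Omega> by fact
  let ?I = "{..<n} \<times> {..<n}"
  have Mm: "M \<in> measurable \<Omega> (count_space (carrier_mat n n))"
    using M by (simp add: balanced_random_matrix_def)
  have iv: "indep_vars (\<lambda>_. count_space UNIV) (\<lambda>(i, j) \<omega>. M \<omega> $$ (i, j)) ?I"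
    using M by (simp add: balanced_random_matrix_def)
  have MA: "M \<omega> \<in> carrier_mat n n" if "\<omega> \<in> space \<Omega>" for \<omega>
    using measurable_space[OF Mm that] by simp
  let ?X = "\<lambda>ij. (\<lambda>(i, j) \<omega>. M \<omega> $$ (i, j)) ij"
  have ev: "{\<omega> \<in> space \<Omega>. M \<omega> = A} = (\<Inter>ij\<in>?I. ?X ij -` {A $$ ij} \<inter> space \<Omega>)"
  proof (intro equalityI subsetI)
    fix \<omega> assume w: "\<omega> \<in> (\<Inter>ij\<in>?I. ?X ij -` {A $$ ij} \<inter> space \<Omega>)"
    have "(0, 0) \<in> ?I" using n by simp
    with w have s: "\<omega> \<in> space \<Omega>" by blast
    have "M \<omega> $$ (i, j) = A $$ (i, j)" if "i < n" "j < n" for i j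
    proof -
      have "(i, j) \<in> ?I" using that by simp
      with w have "\<omega> \<in> ?X (i, j) -` {A $$ (i, j)} \<inter> space \<Omega>" by blast
      then show ?thesis by simp
    qed
    then have "M \<omega> = A" using MA[OF s] A by (intro eq_matI) auto
    then show "\<omega> \<in> {\<omega> \<in> space \<Omega>. M \<omega> = A}" using s by simp
  qed auto
  have "\<P>(\<omega> in \<Omega>. M \<omega> = A) = (\<Prod>ij\<in>?I. prob (?X ij -` {A $$ ij} \<inter> space \<Omega>))"
    unfolding ev by (rule indep_varsD[OF iv]) (use n in auto)
  also have "\<dots> = (\<Prod>(i, j)\<in>?I. entry_law \<Omega> M i j (A $$ (i, j)))"
    by (intro prod.cong refl) (auto simp: entry_law_def vimage_def Int_def conj_commute)
  also have "\<dots> = (\<Prod>i<n. \<Prod>j<n. entry_law \<Omega> M i j (A $$ (i, j)))"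
    by (simp add: prod.cartesian_product)
  also have "\<dots> = (\<Prod>i<n. row_prob n (entry_law \<Omega> M i) (row A i))"
    unfolding row_prob_def using A by (intro prod.cong refl) auto
  finally show ?thesis .
qed

lemma prob_mat_ker:
  fixes M :: "'w \<Rightarrow> 'a::{finite,field} mat"
  assumes ps: "prob_space \<Omega>" and M: "balanced_random_matrix \<alpha> n \<Omega> M" and n: "0 < n"
  shows "\<P>(\<omega> in \<Omega>. P (mat_ker n (M \<omega>))) = row_expect n (entry_law \<Omega> M) n (\<lambda>U. of_bool (P U))"
proof -
  interpret prob_space \<Omega> by fact
  have Mm: "M \<in> measurable \<Omega> (count_space (carrier_mat n n))"
    using M by (simp add: balanced_random_matrix_def)
  let ?f = "\<lambda>g. (\<Prod>i<n. row_prob n (entry_law \<Omega> M i) (g i)) *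
      of_bool (P {x \<in> carrier_vec n. \<forall>i<n. g i \<bullet> x = 0})"
  have "\<P>(\<omega> in \<Omega>. P (mat_ker n (M \<omega>))) =
      (\<Sum>A\<in>carrier_mat n n. \<P>(\<omega> in \<Omega>. M \<omega> = A) * of_bool (P (mat_ker n A)))"
    using prob_eq_sum_countspace[OF Mm finite_carrier_mat, of "\<lambda>A. P (mat_ker n A)"] .
  also have "\<dots> = (\<Sum>A\<in>carrier_mat n n. ?f (row A))"
    by (intro sum.cong refl) (simp add: prob_eq_matrix[OF ps M n] mat_ker_eq)
  also have "\<dots> = (\<Sum>g\<in>PiE {..<n} (\<lambda>_. carrier_vec n). ?f g)"
    by (rule sum_carrier_mat) simp
  also have "\<dots> = row_expect n (entry_law \<Omega> M) n (\<lambda>U. of_bool (P U))"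
    by (simp only: row_expect_eq_sum)
  finally show ?thesis .
qed

section \<open>Limiting laws of kernels and coranks\<close>

text \<open>The order of quantifiers is the point: \<delta> is obtained before the space, the
  matrix, H and the target, so the same bound holds for all images of the second matrix and survives
  averaging over them.\<close>

lemma mat_ker_law_approx:
  fixes b :: nat
  assumes "0 < \<alpha>"
  obtains \<delta> :: "nat \<Rightarrow> real" where "\<delta> \<longlonglongrightarrow> 0"
    "\<And>n \<Omega> (M :: 'w \<Rightarrow> 'p::prime_card mod_ring mat) H i j.
       prob_space \<Omega> \<Longrightarrow> balanced_random_matrix \<alpha> n \<Omega> M \<Longrightarrow> 0 < n \<Longrightarrow> b \<le> n \<Longrightarrow> is_subspace n H \<Longrightarrow>
       card H = CARD('p) ^ (n - b) \<Longrightarrow>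
       \<bar>\<P>(\<omega> in \<Omega>. log_card (mat_ker n (M \<omega>)) - log_card (mat_ker n (M \<omega>) \<inter> H) = i \<and> log_card (mat_ker n (M \<omega>) \<inter> H) = j)
          - dim_chain (1 / real CARD('p)) i j n b (n - b)\<bar> \<le> \<delta> n"
proof -
  obtain \<rho> where \<rho>: "char_bound TYPE('p mod_ring) \<alpha> \<rho>" using char_bound_exists[OF assms] .
  then have \<rho>01: "0 < \<rho>" "\<rho> < 1" by (auto simp: char_bound_def)
  define q where "q = 1 / real CARD('p)"
  have q: "0 < q" "q < 1" using card_field_gt_1[where 'a = "'p mod_ring"] by (auto simp: q_def)
  define \<tau> where "\<tau> = sqrt (q + (1 - q) * \<rho>)"
  have "(1 - q) * \<rho> < (1 - q) * 1" using \<rho>01 q by (intro mult_strict_left_mono) auto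
  then have "q + (1 - q) * \<rho> < 1" by (simp add: algebra_simps)
  moreover have "0 < q + (1 - q) * \<rho>" using q \<rho>01 by (intro add_pos_nonneg) auto
  ultimately have \<tau>: "0 < \<tau>" "\<tau> < 1" by (simp_all add: \<tau>_def)
  have p1: "1 \<le> real CARD('p)" using card_field_gt_1[where 'a = "'p mod_ring"] by simp
  obtain \<mu> m where \<mu>: "0 < \<mu>" "\<mu> \<le> 1" and lim: "(\<lambda>n. 2 * real n * (\<rho> ^ m n + real CARD('p) ^ b *
      ((1 + (real CARD('p) - 1) * \<mu>) * \<tau>) ^ n / \<mu> ^ m n)) \<longlonglongrightarrow> 0"
    using error_rate[OF \<rho>01 \<tau> p1, of "real CARD('p) ^ b"] by auto
  show ?thesis
  proof (rule that[OF lim])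
    fix n \<Omega> and M :: "'w \<Rightarrow> 'p mod_ring mat" and H :: "'p mod_ring vec set" and i j
    assume ps: "prob_space \<Omega>" and M: "balanced_random_matrix \<alpha> n \<Omega> M" and n: "0 < n" "b \<le> n"
      and H: "is_subspace n H" "card H = CARD('p) ^ (n - b)"
    interpret row_chain_subspace n "entry_law \<Omega> M" \<rho> q H b
    proof
      fix k assume k: "k < n"
      note bal = balanced_row_entry_law[OF ps M k]
      show "0 \<le> row_prob n (entry_law \<Omega> M k) r" for r using row_prob_nonneg[OF bal] .
      show "(\<Sum>r\<in>carrier_vec n. row_prob n (entry_law \<Omega> M k) r) = 1" using sum_row_prob[OF bal] .
      show "\<bar>perp_prob n (entry_law \<Omega> M k) U - 1 / real (card U)\<bar> \<le> char_error n \<rho> U" if "is_subspace n U" for U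
        using perp_prob_approx[OF \<rho> bal that] .
    qed (use \<rho>01 n H in \<open>auto simp: q_def\<close>)
    show "\<bar>\<P>(\<omega> in \<Omega>. log_card (mat_ker n (M \<omega>)) - log_card (mat_ker n (M \<omega>) \<inter> H) = i \<and> log_card (mat_ker n (M \<omega>) \<inter> H) = j)
          - dim_chain (1 / real CARD('p)) i j n b (n - b)\<bar> \<le> 2 * real n * (\<rho> ^ m n + real CARD('p) ^ b *
      ((1 + (real CARD('p) - 1) * \<mu>) * \<tau>) ^ n / \<mu> ^ m n)"
      using row_expect_approx[OF \<mu>, of i j "m n"]
        prob_mat_ker[OF ps M n(1), of "\<lambda>U. log_card U - log_card (U \<inter> H) = i \<and> log_card (U \<inter> H) = j"]
      by (simp add: state_value_def[abs_def] q_def \<tau>_def)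
  qed
qed

lemma log_card_mat_ker: "A \<in> carrier_mat n n \<Longrightarrow> log_card (mat_ker n (A :: 'a::{finite,field} mat)) = corank A"
  by (intro log_card_eq card_mat_ker)

text \<open>With H the image of B, the final state (i, j) of the chain encodes both coranks of
  interest. The bounds on the corank of the product show that the subtractions are not
  truncated.\<close>

lemma log_card_mat_ker_image_iff:
  fixes A B :: "'a::{finite,field} mat"
  assumes A: "A \<in> carrier_mat n n" and B: "B \<in> carrier_mat n n"
  defines "I \<equiv> mat_ker n A \<inter> (\<lambda>x. B *\<^sub>v x) ` carrier_vec n"
  shows "log_card (mat_ker n A) - log_card I = i \<and> log_card I = j \<longleftrightarrow> corank A = i + j \<and> corank (A * B) = corank B + j"
proof -
  have "corank (A * B) = corank B + (corank (A * B) - corank B)"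
    using corank_mult_eq_iff(2)[OF A B] by simp
  then have "card I = CARD('a) ^ (corank (A * B) - corank B)"
    using corank_mult_eq_iff(1)[OF A B] unfolding I_def by metis
  then have "log_card I = corank (A * B) - corank B" by (rule log_card_eq)
  then show ?thesis
    using log_card_mat_ker[OF A] corank_mult_eq_iff(2,3)[OF A B] by auto
qed

text \<open>The case b = 0 of the kernel law, with H the whole space: the first component of the
  state stays 0 and the second one is the corank.\<close>

lemma corank_prob_tendsto:
  fixes M :: "nat \<Rightarrow> 'w \<Rightarrow> 'p::prime_card mod_ring mat"
  assumes \<alpha>: "0 < \<alpha>" and ps: "\<And>n. prob_space (\<Omega> n)"
    and M: "\<And>n. balanced_random_matrix \<alpha> n (\<Omega> n) (M n)"
    and L: "qpoch CARD('p) \<longlonglongrightarrow> L" "0 < L"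
  shows "(\<lambda>n. \<P>(\<omega> in \<Omega> n. corank (M n \<omega>) = a)) \<longlonglongrightarrow>
    (1 / real CARD('p)) ^ (a\<^sup>2) * L / (qpoch CARD('p) a)\<^sup>2"
proof -
  let ?q = "1 / real CARD('p)"
  obtain \<delta> where \<delta>: "\<delta> \<longlonglongrightarrow> 0" and app: "\<And>n \<Omega> (M :: 'w \<Rightarrow> 'p::prime_card mod_ring mat) H i j.
       prob_space \<Omega> \<Longrightarrow> balanced_random_matrix \<alpha> n \<Omega> M \<Longrightarrow> 0 < n \<Longrightarrow> 0 \<le> n \<Longrightarrow> is_subspace n H \<Longrightarrow>
       card H = CARD('p) ^ (n - 0) \<Longrightarrow>
       \<bar>\<P>(\<omega> in \<Omega>. log_card (mat_ker n (M \<omega>)) - log_card (mat_ker n (M \<omega>) \<inter> H) = i \<and> log_card (mat_ker n (M \<omega>) \<inter> H) = j)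
          - dim_chain (1 / real CARD('p)) i j n 0 (n - 0)\<bar> \<le> \<delta> n"
    using mat_ker_law_approx[OF \<alpha>, where b = 0 and 'w = 'w and 'p = 'p] by blast
  have p2: "2 \<le> CARD('p)" using card_field_gt_1[where 'a = "'p mod_ring"] by simp
  have g: "(\<lambda>n. dim_chain ?q 0 a n 0 (n - 0)) \<longlonglongrightarrow> ?q ^ (a\<^sup>2) * L / (qpoch CARD('p) a)\<^sup>2"
    using dim_chain_tendsto[OF p2 L, of 0 0 a] by (simp add: power2_eq_square)
  have bd: "\<bar>\<P>(\<omega> in \<Omega> n. corank (M n \<omega>) = a) - dim_chain ?q 0 a n 0 (n - 0)\<bar> \<le> \<delta> n" if n: "0 < n" for n
  proof -
    have Mm: "M n \<in> measurable (\<Omega> n) (count_space (carrier_mat n n))"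
      using M by (simp add: balanced_random_matrix_def)
    have "{\<omega> \<in> space (\<Omega> n). log_card (mat_ker n (M n \<omega>)) - log_card (mat_ker n (M n \<omega>) \<inter> carrier_vec n) = 0 \<and>
        log_card (mat_ker n (M n \<omega>) \<inter> carrier_vec n) = a} = {\<omega> \<in> space (\<Omega> n). corank (M n \<omega>) = a}"
    proof (intro Collect_cong conj_cong refl)
      fix \<omega> assume "\<omega> \<in> space (\<Omega> n)"
      then have Mc: "M n \<omega> \<in> carrier_mat n n" using measurable_space[OF Mm] by simp
      have "mat_ker n (M n \<omega>) \<inter> carrier_vec n = mat_ker n (M n \<omega>)" by (auto simp: mat_ker_def)
      then show "(log_card (mat_ker n (M n \<omega>)) - log_card (mat_ker n (M n \<omega>) \<inter> carrier_vec n) = 0 \<and>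
        log_card (mat_ker n (M n \<omega>) \<inter> carrier_vec n) = a) = (corank (M n \<omega>) = a)"
        using log_card_mat_ker[OF Mc] by simp
    qed
    then show ?thesis
      using app[OF ps M n, of "carrier_vec n" 0 a] by (simp add: is_subspace_carrier_vec card_carrier_vec)
  qed
  have "\<forall>\<^sub>F n in sequentially. norm (\<P>(\<omega> in \<Omega> n. corank (M n \<omega>) = a) - dim_chain ?q 0 a n 0 (n - 0)) \<le> \<delta> n"
    using eventually_gt_at_top[of "0 :: nat"] by eventually_elim (simp only: bd real_norm_def)
  then have "(\<lambda>n. \<P>(\<omega> in \<Omega> n. corank (M n \<omega>) = a) - dim_chain ?q 0 a n 0 (n - 0)) \<longlonglongrightarrow> 0"
    by (rule Lim_null_comparison[OF _ \<delta>])
  from tendsto_add[OF this g] show ?thesis by simp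
qed

text \<open>Freezes Y at each of its finitely many values while X keeps its law; this is Fubini as a
  finite sum.\<close>

lemma (in prob_space) prob_indep_countspace:
  assumes ind: "indep_var (count_space A) X (count_space B) Y" and A: "finite A" and B: "finite B"
  shows "\<P>(\<omega> in M. P (X \<omega>) (Y \<omega>)) = (\<Sum>b\<in>B. \<P>(\<omega> in M. Y \<omega> = b) * \<P>(\<omega> in M. P (X \<omega>) b))"
proof -
  have X: "X \<in> measurable M (count_space A)" and Y: "Y \<in> measurable M (count_space B)"
    using ind by (auto dest: indep_var_rv1 indep_var_rv2)
  have XY: "(\<lambda>\<omega>. (X \<omega>, Y \<omega>)) \<in> measurable M (count_space (A \<times> B))"
    using measurable_Pair[OF X Y] A B by (simp add: pair_measure_countable countable_finite)
  have pr: "\<P>(\<omega> in M. (X \<omega>, Y \<omega>) = (a, b)) = \<P>(\<omega> in M. X \<omega> = a) * \<P>(\<omega> in M. Y \<omega> = b)"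
    if "a \<in> A" "b \<in> B" for a b
    using indep_varD[OF ind, of "{a}" "{b}"] that
    by (simp add: vimage_def Int_def conj_commute)
  have "\<P>(\<omega> in M. P (X \<omega>) (Y \<omega>)) =
      (\<Sum>ab\<in>A \<times> B. \<P>(\<omega> in M. (X \<omega>, Y \<omega>) = ab) * of_bool (P (fst ab) (snd ab)))"
    using prob_eq_sum_countspace[OF XY finite_cartesian_product[OF A B], of "\<lambda>ab. P (fst ab) (snd ab)"]
    by simp
  also have "\<dots> = (\<Sum>(a, b)\<in>A \<times> B. \<P>(\<omega> in M. Y \<omega> = b) * (\<P>(\<omega> in M. X \<omega> = a) * of_bool (P a b)))"
    by (intro sum.cong refl) (auto simp: pr simp del: prod.inject)
  also have "\<dots> = (\<Sum>b\<in>B. \<Sum>a\<in>A. \<P>(\<omega> in M. Y \<omega> = b) * (\<P>(\<omega> in M. X \<omega> = a) * of_bool (P a b)))"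
    by (subst sum.swap) (simp add: sum.cartesian_product)
  also have "\<dots> = (\<Sum>b\<in>B. \<P>(\<omega> in M. Y \<omega> = b) * \<P>(\<omega> in M. P (X \<omega>) b))"
    using prob_eq_sum_countspace[OF X A, of "\<lambda>a. P a _"] by (simp add: sum_distrib_left)
  finally show ?thesis .
qed

text \<open>For i = a + b - c and j = c - b one has i + j = a and b - i = c - a. Hence L and the
  power with exponent \<open>a\<^sup>2\<close> cancel against the limiting probability of corank a,
  and the exponent (c - b) * (c - a) remains.\<close>

lemma limit_value:
  assumes p: "2 \<le> p" and L: "(L::real) \<noteq> 0" and c: "a \<le> c" "b \<le> c" "c \<le> a + b"
  shows "(1 / real p) ^ ((a + b - c + (c - b))\<^sup>2 + (c - b) * (b - (a + b - c))) * L * qpoch p b /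
      (qpoch p (a + b - c) * qpoch p (c - b) * qpoch p (b - (a + b - c)) * qpoch p (a + b - c + (c - b))) /
      ((1 / real p) ^ (a\<^sup>2) * L / (qpoch p a)\<^sup>2) =
    real p powi (- ((int c - int a) * (int c - int b))) * (qpoch p a * qpoch p b)
          * (inv_qpoch p (int c - int b) * inv_qpoch p (int a + int b - int c)
             * inv_qpoch p (int c - int a))"
proof -
  have Q: "qpoch p m \<noteq> 0" for m using qpoch_pos[OF p, of m] by simp
  have ij: "a + b - c + (c - b) = a" "b - (a + b - c) = c - a" using c by auto
  have "nat (int c - int b) = c - b" "nat (int a + int b - int c) = a + b - c" "nat (int c - int a) = c - a"
    using c by auto
  then have inv: "inv_qpoch p (int c - int b) = 1 / qpoch p (c - b)"
    "inv_qpoch p (int a + int b - int c) = 1 / qpoch p (a + b - c)"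
    "inv_qpoch p (int c - int a) = 1 / qpoch p (c - a)"
    using c by (auto simp: inv_qpoch_def)
  have "(int c - int a) * (int c - int b) = int ((c - b) * (c - a))"
    using c by (simp add: of_nat_diff mult.commute)
  then have pw: "real p powi (- ((int c - int a) * (int c - int b))) = (1 / real p) ^ ((c - b) * (c - a))"
    by (simp only: power_int_minus power_int_of_nat) (simp add: power_one_over inverse_eq_divide)
  show ?thesis unfolding ij inv pw power_add using Q L p by (simp add: field_simps power2_eq_square)
qed

text \<open>The limit is taken along S, where the conditional probability is meaningful. That S is
  infinite is asserted as well, because convergence along a trivial filter would be vacuous.\<close>

theorem corollary1p5:
  fixes p :: nat and \<alpha> :: real and a b c :: nat
    and \<Omega> :: "nat \<Rightarrow> 'w measure"
    and M1 M2 :: "nat \<Rightarrow> 'w \<Rightarrow> 'p::prime_card mod_ring mat"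
  assumes p: "p = CARD('p)"
    and \<alpha>: "0 < \<alpha>" "\<alpha> \<le> 1 / 2"
    and prob: "\<And>n. prob_space (\<Omega> n)"
    and M1: "\<And>n. balanced_random_matrix \<alpha> n (\<Omega> n) (M1 n)"
    and M2: "\<And>n. balanced_random_matrix \<alpha> n (\<Omega> n) (M2 n)"
    and indep: "\<And>n. prob_space.indep_var (\<Omega> n)
                  (count_space (carrier_mat n n)) (M1 n)
                  (count_space (carrier_mat n n)) (M2 n)"
  defines "S \<equiv> {n. 0 < \<P>(\<omega> in \<Omega> n. corank (M1 n \<omega>) = a \<and> corank (M2 n \<omega>) = b)}"
  shows "(\<exists>\<^sub>F n in sequentially. n \<in> S) \<and>
    ((\<lambda>n. \<P>(\<omega> in \<Omega> n. corank (M1 n \<omega> * M2 n \<omega>) = c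
             \<bar> corank (M1 n \<omega>) = a \<and> corank (M2 n \<omega>) = b))
      \<longlongrightarrow> real p powi (- ((int c - int a) * (int c - int b))) * (qpoch p a * qpoch p b)
          * (inv_qpoch p (int c - int b) * inv_qpoch p (int a + int b - int c)
             * inv_qpoch p (int c - int a)))
      (inf sequentially (principal S))"
proof -
  define q where "q = 1 / real p"
  define R where "R = real p powi (- ((int c - int a) * (int c - int b))) * (qpoch p a * qpoch p b)
          * (inv_qpoch p (int c - int b) * inv_qpoch p (int a + int b - int c)
             * inv_qpoch p (int c - int a))"
  have p2: "2 \<le> p" using card_field_gt_1[where 'a = "'p mod_ring"] p by simp
  obtain L where L: "0 < L" "qpoch p \<longlonglongrightarrow> L" using qpoch_tendsto[OF p2] .
  have L': "qpoch CARD('p) \<longlonglongrightarrow> L" using L p by simp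
  define P1 where "P1 n = \<P>(\<omega> in \<Omega> n. corank (M1 n \<omega>) = a)" for n
  define P2 where "P2 n = \<P>(\<omega> in \<Omega> n. corank (M2 n \<omega>) = b)" for n
  define l1 where "l1 = q ^ (a\<^sup>2) * L / (qpoch p a)\<^sup>2"
  define l2 where "l2 = q ^ (b\<^sup>2) * L / (qpoch p b)\<^sup>2"
  have q0: "0 < q" using p2 by (simp add: q_def)
  have l: "0 < l1" "0 < l2"
    unfolding l1_def l2_def by (intro divide_pos_pos mult_pos_pos zero_less_power q0 L(1) qpoch_pos p2)+
  have P1: "P1 \<longlonglongrightarrow> l1"
    using corank_prob_tendsto[OF \<alpha>(1) prob M1 L' L(1), of a] by (simp add: P1_def[abs_def] l1_def q_def p)
  have P2: "P2 \<longlonglongrightarrow> l2"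
    using corank_prob_tendsto[OF \<alpha>(1) prob M2 L' L(1), of b] by (simp add: P2_def[abs_def] l2_def q_def p)
  have pos: "\<forall>\<^sub>F n in sequentially. 0 < P1 n \<and> 0 < P2 n"
    using order_tendstoD(1)[OF P1 l(1)] order_tendstoD(1)[OF P2 l(2)] by eventually_elim simp
  define J where "J n = \<P>(\<omega> in \<Omega> n. corank (M1 n \<omega> * M2 n \<omega>) = c \<and> corank (M1 n \<omega>) = a \<and> corank (M2 n \<omega>) = b)" for n
  define w2 where "w2 n B = \<P>(\<omega> in \<Omega> n. M2 n \<omega> = B)" for n B
  let ?C = "\<lambda>n. carrier_mat n n :: 'p mod_ring mat set"
  have M1c: "M1 n \<in> measurable (\<Omega> n) (count_space (?C n))"
    and M2c: "M2 n \<in> measurable (\<Omega> n) (count_space (?C n))" for n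
    using M1 M2 by (auto simp: balanced_random_matrix_def)
  have M1C: "M1 n \<omega> \<in> ?C n" and M2C: "M2 n \<omega> \<in> ?C n" if "\<omega> \<in> space (\<Omega> n)" for n \<omega>
    using measurable_space[OF M1c that] measurable_space[OF M2c that] by auto
  have P2_sum: "P2 n = (\<Sum>B\<in>?C n. w2 n B * of_bool (corank B = b))" for n
    using prob_space.prob_eq_sum_countspace[OF prob M2c finite_carrier_mat, of n "\<lambda>B. corank B = b"]
    by (simp add: P2_def w2_def)
  have P12: "\<P>(\<omega> in \<Omega> n. corank (M1 n \<omega>) = a \<and> corank (M2 n \<omega>) = b) = P1 n * P2 n" for n
  proof -
    have "\<P>(\<omega> in \<Omega> n. corank (M1 n \<omega>) = a \<and> corank (M2 n \<omega>) = b) =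
        (\<Sum>B\<in>?C n. w2 n B * \<P>(\<omega> in \<Omega> n. corank (M1 n \<omega>) = a \<and> corank B = b))"
      using prob_space.prob_indep_countspace[OF prob indep finite_carrier_mat finite_carrier_mat,
          of n "\<lambda>A B. corank A = a \<and> corank B = b"] by (simp add: w2_def)
    also have "\<dots> = (\<Sum>B\<in>?C n. P1 n * (w2 n B * of_bool (corank B = b)))"
      by (intro sum.cong refl) (auto simp: P1_def)
    finally show ?thesis by (simp add: P2_sum sum_distrib_left)
  qed
  have J_sum: "J n = (\<Sum>B\<in>?C n. w2 n B * (of_bool (corank B = b) *
      \<P>(\<omega> in \<Omega> n. corank (M1 n \<omega> * B) = c \<and> corank (M1 n \<omega>) = a)))" for n
  proof -
    have "J n = (\<Sum>B\<in>?C n. w2 n B *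
        \<P>(\<omega> in \<Omega> n. corank (M1 n \<omega> * B) = c \<and> corank (M1 n \<omega>) = a \<and> corank B = b))"
      using prob_space.prob_indep_countspace[OF prob indep finite_carrier_mat finite_carrier_mat,
          of n "\<lambda>A B. corank (A * B) = c \<and> corank A = a \<and> corank B = b"] by (simp add: w2_def J_def)
    also have "\<dots> = (\<Sum>B\<in>?C n. w2 n B * (of_bool (corank B = b) *
      \<P>(\<omega> in \<Omega> n. corank (M1 n \<omega> * B) = c \<and> corank (M1 n \<omega>) = a)))"
      by (intro sum.cong refl) auto
    finally show ?thesis .
  qed
  have cond: "\<P>(\<omega> in \<Omega> n. corank (M1 n \<omega> * M2 n \<omega>) = c \<bar> corank (M1 n \<omega>) = a \<and> corank (M2 n \<omega>) = b) =
      J n / (P1 n * P2 n)" for n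
    by (simp add: cond_prob_def J_def P12)
  have main: "(\<lambda>n. J n / (P1 n * P2 n)) \<longlonglongrightarrow> R"
  proof (cases "b \<le> c \<and> c \<le> a + b")
    \<comment> \<open>Here the corank inequalities make the event empty, and a reciprocal with
      negative index makes R zero.\<close>
    case False
    have "J n = 0" for n
    proof -
      have e: "{\<omega> \<in> space (\<Omega> n). corank (M1 n \<omega> * M2 n \<omega>) = c \<and> corank (M1 n \<omega>) = a \<and> corank (M2 n \<omega>) = b} = {}"
        using False corank_mult_eq_iff(2,3)[OF M1C M2C] by force
      show ?thesis unfolding J_def e by simp
    qed
    moreover have "R = 0" using False by (auto simp: R_def inv_qpoch_def)
    ultimately show ?thesis by simp
  next
    case True
    \<comment> \<open>The target state is forced: the corank of the first matrix is i + j, that of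
      the product is b + j.\<close>
    define i where "i = a + b - c"
    define j where "j = c - b"
    have ij: "i + j = a" "b + j = c" using True by (auto simp: i_def j_def)
    define g where "g n = dim_chain q i j n b (n - b)" for n
    obtain \<delta> where \<delta>: "\<delta> \<longlonglongrightarrow> 0" and app: "\<And>n \<Omega> (M :: 'w \<Rightarrow> 'p::prime_card mod_ring mat) H i j.
       prob_space \<Omega> \<Longrightarrow> balanced_random_matrix \<alpha> n \<Omega> M \<Longrightarrow> 0 < n \<Longrightarrow> b \<le> n \<Longrightarrow> is_subspace n H \<Longrightarrow>
       card H = CARD('p) ^ (n - b) \<Longrightarrow>
       \<bar>\<P>(\<omega> in \<Omega>. log_card (mat_ker n (M \<omega>)) - log_card (mat_ker n (M \<omega>) \<inter> H) = i \<and> log_card (mat_ker n (M \<omega>) \<inter> H) = j)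
          - dim_chain (1 / real CARD('p)) i j n b (n - b)\<bar> \<le> \<delta> n"
      using mat_ker_law_approx[OF \<alpha>(1), where b = b and 'w = 'w and 'p = 'p] by blast
    have ap: "\<bar>\<P>(\<omega> in \<Omega> n. corank (M1 n \<omega> * B) = c \<and> corank (M1 n \<omega>) = a) - g n\<bar> \<le> \<delta> n"
      if n: "0 < n" "b \<le> n" and B: "B \<in> ?C n" "corank B = b" for n B
    proof -
      let ?H = "(\<lambda>x. B *\<^sub>v x) ` carrier_vec n"
      have "{\<omega> \<in> space (\<Omega> n). corank (M1 n \<omega> * B) = c \<and> corank (M1 n \<omega>) = a} =
        {\<omega> \<in> space (\<Omega> n). log_card (mat_ker n (M1 n \<omega>)) - log_card (mat_ker n (M1 n \<omega>) \<inter> ?H) = i \<and> log_card (mat_ker n (M1 n \<omega>) \<inter> ?H) = j}"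
        using log_card_mat_ker_image_iff[OF M1C B(1)] B(2) ij by auto
      then show ?thesis
        using app[OF prob M1 n is_subspace_image[OF B(1)], of i j] card_image_corank(1)[OF B(1)] B(2)
        by (simp add: g_def q_def p)
    qed
    \<comment> \<open>\<open>\<delta> n\<close> is the same for every B, and the weights of the B
      with corank b add up to \<open>P2 n\<close>. Dividing by \<open>P2 n\<close> is harmless since
      its limit is positive.\<close>
    have bound: "\<bar>J n - g n * P2 n\<bar> \<le> \<delta> n * P2 n" if n: "0 < n" "b \<le> n" for n
    proof -
      have "J n - g n * P2 n = (\<Sum>B\<in>?C n. w2 n B * (of_bool (corank B = b) *
          (\<P>(\<omega> in \<Omega> n. corank (M1 n \<omega> * B) = c \<and> corank (M1 n \<omega>) = a) - g n)))"
        unfolding J_sum P2_sum sum_distrib_left sum_subtractf[symmetric]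
        by (intro sum.cong refl) (simp add: algebra_simps)
      also have "\<bar>\<dots>\<bar> \<le> (\<Sum>B\<in>?C n. w2 n B * (of_bool (corank B = b) * \<delta> n))"
      proof (rule order_trans[OF sum_abs], rule sum_mono)
        fix B assume B: "B \<in> ?C n"
        have "0 \<le> w2 n B" by (simp add: w2_def)
        then show "\<bar>w2 n B * (of_bool (corank B = b) *
          (\<P>(\<omega> in \<Omega> n. corank (M1 n \<omega> * B) = c \<and> corank (M1 n \<omega>) = a) - g n))\<bar>
          \<le> w2 n B * (of_bool (corank B = b) * \<delta> n)"
          using ap[OF n B] by (cases "corank B = b") (auto simp: abs_mult intro!: mult_left_mono)
      qed
      also have "\<dots> = \<delta> n * P2 n"
        unfolding P2_sum sum_distrib_left by (intro sum.cong refl) simp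
      finally show ?thesis .
    qed
    have "\<forall>\<^sub>F n in sequentially. norm (J n / P2 n - g n) \<le> \<delta> n"
      using pos eventually_gt_at_top[of 0] eventually_ge_at_top[of b]
    proof eventually_elim
      case (elim n)
      have "J n / P2 n - g n = (J n - g n * P2 n) / P2 n" using elim by (simp add: field_simps)
      then have "norm (J n / P2 n - g n) = \<bar>J n - g n * P2 n\<bar> / P2 n" using elim by (simp add: abs_divide)
      also have "\<dots> \<le> \<delta> n * P2 n / P2 n" using bound[of n] elim by (intro divide_right_mono) auto
      finally show ?case using elim by simp
    qed
    then have "(\<lambda>n. J n / P2 n - g n) \<longlonglongrightarrow> 0" by (rule Lim_null_comparison[OF _ \<delta>])
    moreover have "g \<longlonglongrightarrow> R * l1"
    proof (cases "a \<le> c")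
      \<comment> \<open>Now i exceeds b, while the first component starts at b and can only fall, so
        the target is unreachable. Thus the constraint \<open>a \<le> c\<close> comes from the
        chain, unlike the other two, which came from corank inequalities.\<close>
      case False
      then have "g = (\<lambda>_. 0)" unfolding g_def using True by (intro ext dim_chain_eq_0) (auto simp: i_def)
      moreover have "R = 0" using False by (auto simp: R_def inv_qpoch_def)
      ultimately show ?thesis by simp
    next
      case ac: True
      have "i \<le> b" using ac by (simp add: i_def)
      note lim = dim_chain_tendsto[OF p2 L(2,1) this, of j]
      define l3 where "l3 = q ^ ((i + j)\<^sup>2 + j * (b - i)) * L * qpoch p b /
        (qpoch p i * qpoch p j * qpoch p (b - i) * qpoch p (i + j))"
      have "g \<longlonglongrightarrow> l3" using lim unfolding l3_def g_def q_def .
      moreover have "l3 / l1 = R"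
        unfolding l3_def i_def j_def R_def l1_def q_def using L ac True by (intro limit_value[OF p2]) auto
      then have "l3 = R * l1" using l(1) by (simp add: field_simps)
      ultimately show ?thesis by simp
    qed
    ultimately have "(\<lambda>n. J n / P2 n) \<longlonglongrightarrow> R * l1"
      using tendsto_add[of "\<lambda>n. J n / P2 n - g n" 0 sequentially g] by simp
    then have "(\<lambda>n. J n / P2 n / P1 n) \<longlonglongrightarrow> R * l1 / l1"
      using P1 l by (intro tendsto_divide) auto
    then show ?thesis using l by (simp add: mult.commute)
  qed
  have "\<forall>\<^sub>F n in sequentially. n \<in> S"
    using pos by eventually_elim (simp add: S_def P12)
  then have "\<exists>\<^sub>F n in sequentially. n \<in> S" by (simp add: eventually_frequently)
  moreover have "((\<lambda>n. J n / (P1 n * P2 n)) \<longlongrightarrow> R) (inf sequentially (principal S))"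
    using main by (rule tendsto_mono[rotated]) simp
  ultimately show ?thesis unfolding cond R_def by simp
qed

end
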